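(* Fix $c>0$ and $k\in(0,\sqrt{c}/2)$. The solitary wave momentum density $\mu=\mu(\cdot;k)$ is a critical point of the action functional $$\Lambda(m)=\omega_0\,\mathcal{E}(m)+\omega_1F_1(m)+F_2(m),\qquad m\in X_k,$$ provided we take $$\omega_0=-9a^{-2/3}\quad\text{and}\quad \omega_1=9c\,a^{-4/3}(2E+c),$$ where $a=k(c-k^2)^{3/2}$ and $E=\frac{k^2(c-2k^2)}{2c}$.
   Context: Setting: the Novikov equation is $u_t-u_{xxt}=u^2u_{xxx}-4u^2u_x+3uu_xu_{xx}$. For fixed $c>0$ and $k\in(0,\sqrt c/2)$, set $a=k(c-k^2)^{3/2}$ and $E=\frac{k^2(c-2k^2)}{2c}$; $\phi=\phi(\cdot;k)$ denotes the unique nonconstant smooth even function on $\mathbb{R}$ with $\phi'(0)=0$, $\phi(x)\to k$ as $x\to\pm\infty$, $\phi^2<c$, and $\phi-\phi''=a(c-\phi^2)^{-3/2}$ (so that $u(x,t)=\phi(x-ct)$ is a smooth solitary wave of the Novikov equation). It also satisfies $\frac12(\phi')^2=E+\frac12\phi^2-\frac{a\phi}{c\sqrt{c-\phi^2}}$. Its momentum density is $\mu=\mu(\cdot;k)=\phi-\phi''>0$. $X_k$ is the set of functions $m$ on $\mathbb{R}$ with $m-k\in H^1(\mathbb{R})$ and $m(x)>0$ for all $x$. The operator $(1-\partial_x^2)^{-1}$ is convolution with $\frac12e^{-|x|}$ (so $(1-\partial_x^2)^{-1}\mu=\phi$). For $m\in X_k$, $$\mathcal{E}(m)=\int_{\mathbb{R}}\left(m(1-\partial_x^2)^{-1}m-k^2\right)dx,\quad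 F_1(m)=\int_{\mathbb{R}}\left(m^{2/3}-k^{2/3}\right)dx,$$ $$F_2(m)=\int_{\mathbb{R}}\left(m^{-8/3}m_x^2+9\left(m^{-2/3}-k^{-2/3}\right)\right)dx.$$ Only the variation of the combination $\Lambda$ (not those of $\mathcal{E},F_1,F_2$ separately) is meaningful on $X_k$ because of the nonzero end state. That $\mu$ is a critical point of $\Lambda$ means $\frac{\delta\Lambda}{\delta m}(\mu)=0$, i.e. the Euler–Lagrange equation $$2\omega_0(1-\partial_x^2)^{-1}\mu+\frac{2\omega_1}{3\mu^{1/3}}-2\mu^{-8/3}\mu''-6\mu^{-5/3}+\frac{8(\mu')^2}{3\mu^{11/3}}=0\quad\text{on }\mathbb{R}.$$ *)

theory Defs
  imports "HOL-Analysis.Analysis"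
begin

definition smooth :: "(real \<Rightarrow> real) \<Rightarrow> bool" where
  "smooth f \<longleftrightarrow> (\<forall>n. (deriv ^^ n) f differentiable_on UNIV)"

definition test_function :: "(real \<Rightarrow> real) \<Rightarrow> bool" where
  "test_function h \<longleftrightarrow> smooth h \<and> compact (closure {x. h x \<noteq> 0})"

(* The Sobolev space H^1(R), each class being represented by its locally absolutely continuous
   member.  Such a function is differentiable almost everywhere and its a.e. derivative is its weak
   derivative; the value of deriv on the exceptional null set is irrelevant. *)
definition sobolev_H1 :: "(real \<Rightarrow> real) set" where
  "sobolev_H1 = {f.
     (\<forall>a b. a \<le> b \<longrightarrow> set_integrable lborel {a..b} (deriv f) \<and>
                       f b - f a = (LINT x:{a..b}|lborel. deriv f x)) \<and>
     integrable lborel (\<lambda>x. (f x)\<^sup>2) \<and>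
     integrable lborel (\<lambda>x. (deriv f x)\<^sup>2)}"

definition X_space :: "real \<Rightarrow> (real \<Rightarrow> real) set" where
  "X_space k = {m. (\<lambda>x. m x - k) \<in> sobolev_H1 \<and> (\<forall>x. m x > 0)}"

(* (1 - d^2/dx^2)^{-1} *)
definition helmholtz_inv :: "(real \<Rightarrow> real) \<Rightarrow> real \<Rightarrow> real" where
  "helmholtz_inv f x = (LINT y|lborel. exp (- \<bar>x - y\<bar>) / 2 * f y)"

definition energy_density :: "real \<Rightarrow> (real \<Rightarrow> real) \<Rightarrow> real \<Rightarrow> real" where
  "energy_density k m x = m x * helmholtz_inv m x - k\<^sup>2"

definition F1_density :: "real \<Rightarrow> (real \<Rightarrow> real) \<Rightarrow> real \<Rightarrow> real" where
  "F1_density k m x = m x powr (2/3) - k powr (2/3)"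

definition F2_density :: "real \<Rightarrow> (real \<Rightarrow> real) \<Rightarrow> real \<Rightarrow> real" where
  "F2_density k m x =
     m x powr (-8/3) * (deriv m x)\<^sup>2 + 9 * (m x powr (-2/3) - k powr (-2/3))"

definition energy :: "real \<Rightarrow> (real \<Rightarrow> real) \<Rightarrow> real" where
  "energy k m = (LINT x|lborel. energy_density k m x)"

definition F1 :: "real \<Rightarrow> (real \<Rightarrow> real) \<Rightarrow> real" where
  "F1 k m = (LINT x|lborel. F1_density k m x)"

definition F2 :: "real \<Rightarrow> (real \<Rightarrow> real) \<Rightarrow> real" where
  "F2 k m = (LINT x|lborel. F2_density k m x)"

definition action :: "real \<Rightarrow> real \<Rightarrow> real \<Rightarrow> (real \<Rightarrow> real) \<Rightarrow> real" where
  "action k \<omega>0 \<omega>1 m = \<omega>0 * energy k m + \<omega>1 * F1 k m + F2 k m"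

(* Because of the end state k > 0 the three integrals need not converge on all of X_k (m - k need
   not be in L^1), and a divergent Lebesgue integral has the default value 0.  This is the part of
   X_k on which the action is a genuine number. *)
definition action_domain :: "real \<Rightarrow> (real \<Rightarrow> real) set" where
  "action_domain k = {m \<in> X_space k.
     integrable lborel (energy_density k m) \<and>
     integrable lborel (F1_density k m) \<and>
     integrable lborel (F2_density k m)}"

(* g is the variational derivative (delta L / delta m)(m) of a functional L defined on D. *)
definition has_variational_derivative ::
  "(real \<Rightarrow> real) set \<Rightarrow> ((real \<Rightarrow> real) \<Rightarrow> real) \<Rightarrow> (real \<Rightarrow> real) \<Rightarrow> (real \<Rightarrow> real) \<Rightarrow> bool" where
  "has_variational_derivative D L m g \<longleftrightarrow>
     (\<forall>h. test_function h \<longrightarrow>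
        (\<forall>\<^sub>F \<epsilon> in nhds 0. (\<lambda>x. m x + \<epsilon> * h x) \<in> D) \<and>
        integrable lborel (\<lambda>x. g x * h x) \<and>
        ((\<lambda>\<epsilon>. L (\<lambda>x. m x + \<epsilon> * h x)) has_real_derivative (LINT x|lborel. g x * h x)) (at 0))"

definition critical_point ::
  "(real \<Rightarrow> real) set \<Rightarrow> ((real \<Rightarrow> real) \<Rightarrow> real) \<Rightarrow> (real \<Rightarrow> real) \<Rightarrow> bool" where
  "critical_point D L m \<longleftrightarrow> m \<in> D \<and> has_variational_derivative D L m (\<lambda>x. 0)"

definition wave_a :: "real \<Rightarrow> real \<Rightarrow> real" where
  "wave_a c k = k * (c - k\<^sup>2) powr (3/2)"

definition wave_E :: "real \<Rightarrow> real \<Rightarrow> real" where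
  "wave_E c k = k\<^sup>2 * (c - 2 * k\<^sup>2) / (2 * c)"

definition solitary_wave :: "real \<Rightarrow> real \<Rightarrow> (real \<Rightarrow> real) \<Rightarrow> bool" where
  "solitary_wave c k \<phi> \<longleftrightarrow>
     smooth \<phi> \<and>
     \<not> \<phi> constant_on UNIV \<and>
     (\<forall>x. \<phi> (- x) = \<phi> x) \<and>
     deriv \<phi> 0 = 0 \<and>
     (\<phi> \<longlongrightarrow> k) at_top \<and> (\<phi> \<longlongrightarrow> k) at_bot \<and>
     (\<forall>x. (\<phi> x)\<^sup>2 < c) \<and>
     (\<forall>x. \<phi> x - deriv (deriv \<phi>) x = wave_a c k * (c - (\<phi> x)\<^sup>2) powr (-3/2))"

definition momentum :: "(real \<Rightarrow> real) \<Rightarrow> real \<Rightarrow> real" where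
  "momentum \<phi> x = \<phi> x - deriv (deriv \<phi>) x"

(* The Euler-Lagrange expression delta Lambda / delta m. *)
definition action_gradient :: "real \<Rightarrow> real \<Rightarrow> (real \<Rightarrow> real) \<Rightarrow> real \<Rightarrow> real" where
  "action_gradient \<omega>0 \<omega>1 m x =
     2 * \<omega>0 * helmholtz_inv m x
     + 2 * \<omega>1 / (3 * m x powr (1/3))
     - 2 * m x powr (-8/3) * deriv (deriv m) x
     - 6 * m x powr (-5/3)
     + 8 * (deriv m x)\<^sup>2 / (3 * m x powr (11/3))"

end

theory Submission
  imports Defs
begin

text \<open>
  At a bounded \<open>C\<^sup>2\<close> point of its domain the action has \<open>action_gradient\<close> as variational derivative:
  \<open>F1\<close> and \<open>F2\<close> are integrals of first-order Lagrangians, and \<open>energy\<close> is quadratic with a symmetric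
  kernel. To see that \<open>\<mu>\<close> belongs to the domain, note that \<open>\<phi>\<close> is an orbit of Newton's equation
  \<open>\<phi>'' = f (\<phi>)\<close> homoclinic to \<open>k\<close>, which is a saddle exactly because \<open>4 k\<^sup>2 < c\<close>. Hence \<open>\<phi> - k\<close>
  decays exponentially, and each density is controlled by \<open>C\<^sup>1\<close> functions of \<open>\<phi>\<close> and \<open>\<mu>\<close> minus their
  values at \<open>k\<close>.

  For the Euler-Lagrange equation put \<open>w = \<mu> powr (-1/3)\<close>, a multiple of \<open>r = sqrt (c - \<phi>\<^sup>2)\<close>.
  Since \<open>helmholtz_inv \<mu> = \<phi>\<close>, it reads \<open>\<omega>0 \<phi> + \<omega>1 w / 3 = 3 w\<^sup>4 (w - w'')\<close>, the terms in \<open>w'\<^sup>2\<close>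
  having cancelled, and it becomes an identity once \<open>\<phi>''\<close> is eliminated by the profile equation
  and \<open>\<phi>'\<^sup>2\<close> by its first integral.
\<close>

subsection \<open>Continuous functions with a limit at infinity\<close>

lemma compact_insert_limit_range:
  fixes f :: "'a::{real_normed_vector, heine_borel} \<Rightarrow> 'b::topological_space"
  assumes cont: "continuous_on UNIV f" and lim: "(f \<longlongrightarrow> l) at_infinity"
  shows "compact (insert l (range f))"
proof (rule compactI)
  fix C assume opens: "\<forall>U\<in>C. open U" and cover: "insert l (range f) \<subseteq> \<Union>C"
  then obtain U where U: "U \<in> C" "open U" "l \<in> U"
    by blast
  obtain R where R: "\<And>x. R \<le> norm x \<Longrightarrow> f x \<in> U"
    using topological_tendstoD[OF lim U(2,3)] unfolding eventually_at_infinity by blast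
  have "compact (f ` cball 0 R)"
    by (intro compact_continuous_image continuous_on_subset[OF cont]) auto
  moreover have "f ` cball 0 R \<subseteq> \<Union>C"
    using cover by blast
  ultimately obtain D where D: "D \<subseteq> C" "finite D" "f ` cball 0 R \<subseteq> \<Union>D"
    using opens by (meson compactE)
  have "f x \<in> \<Union>(insert U D)" for x
  proof (cases "norm x \<le> R")
    case True
    then have "f x \<in> f ` cball 0 R" by simp
    then show ?thesis using D(3) by auto
  qed (use R[of x] in simp)
  then have "insert l (range f) \<subseteq> \<Union>(insert U D)"
    using U by auto
  then show "\<exists>C'\<subseteq>C. finite C' \<and> insert l (range f) \<subseteq> \<Union>C'"
    using U D by (intro exI[of _ "insert U D"]) auto
qed

lemma bounded_range_limit_at_infinity:
  fixes f :: "'a::{real_normed_vector, heine_borel} \<Rightarrow> 'b::metric_space"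
  assumes "continuous_on UNIV f" "(f \<longlongrightarrow> l) at_infinity"
  shows "bounded (range f)"
  using compact_imp_bounded[OF compact_insert_limit_range[OF assms]] by simp

lemma integrable_bounded_mult:
  fixes f g :: "'a \<Rightarrow> real"
  assumes f: "integrable M f" and g: "g \<in> borel_measurable M" "bounded (range g)"
  shows "integrable M (\<lambda>x. g x * f x)"
proof -
  obtain B where B: "\<And>x. \<bar>g x\<bar> \<le> B"
    using g(2) by (auto simp: bounded_iff)
  show ?thesis
  proof (rule Bochner_Integration.integrable_bound)
    show "integrable M (\<lambda>x. B * \<bar>f x\<bar>)"
      using f by simp
    show "AE x in M. norm (g x * f x) \<le> norm (B * \<bar>f x\<bar>)"
      by (intro AE_I2) (auto simp: abs_mult intro!: mult_right_mono order_trans[OF B])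
  qed (use f g in simp)
qed

context
  fixes f :: "'a::euclidean_space \<Rightarrow> real" and l :: real and S :: "real set"
  assumes cont: "continuous_on UNIV f" and lim: "(f \<longlongrightarrow> l) at_infinity"
    and range: "insert l (range f) \<subseteq> S"
begin

lemma integrable_comp_mult:
  fixes G :: "real \<Rightarrow> real" and g :: "'a \<Rightarrow> real"
  assumes G: "continuous_on S G" and g: "integrable lborel g"
  shows "integrable lborel (\<lambda>x. G (f x) * g x)"
proof (rule integrable_bounded_mult[OF g])
  have "continuous_on UNIV (\<lambda>x. G (f x))"
    using range by (intro continuous_on_compose2[OF G cont]) auto
  then show "(\<lambda>x. G (f x)) \<in> borel_measurable lborel"
    by (simp add: borel_measurable_continuous_onI)
  have "compact (G ` insert l (range f))"
    by (intro compact_continuous_image compact_insert_limit_range cont lim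
        continuous_on_subset[OF G range])
  then show "bounded (range (\<lambda>x. G (f x)))"
    by (rule bounded_subset[OF compact_imp_bounded]) auto
qed

lemma integrable_comp_diff_limit:
  assumes "convex S"
    and G: "\<And>t. t \<in> S \<Longrightarrow> (G has_real_derivative G' t) (at t)" "continuous_on S G'"
    and f: "integrable lborel (\<lambda>x. f x - l)"
  shows "integrable lborel (\<lambda>x. G (f x) - G l)"
proof -
  let ?K = "convex hull (insert l (range f))"
  have "?K \<subseteq> S"
    using range \<open>convex S\<close> by (rule hull_minimal)
  moreover have "compact ?K"
    by (intro compact_convex_hull compact_insert_limit_range cont lim)
  ultimately have "bounded (G' ` ?K)"
    by (intro compact_imp_bounded compact_continuous_image continuous_on_subset[OF G(2)])
  then obtain B where B: "\<And>t. t \<in> ?K \<Longrightarrow> norm (G' t) \<le> B"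
    by (auto simp: bounded_iff)
  have lipschitz: "norm (G (f x) - G l) \<le> B * norm (f x - l)" for x
    by (rule field_differentiable_bound[of ?K G G'])
       (use \<open>?K \<subseteq> S\<close> B in \<open>auto intro: has_field_derivative_at_within[OF G(1)] hull_inc\<close>)
  have "continuous_on UNIV (\<lambda>x. G (f x))"
    using range
    by (intro continuous_on_compose2[OF _ cont, of S] continuous_at_imp_continuous_on ballI)
       (auto intro: DERIV_isCont[OF G(1)])
  then have [measurable]: "(\<lambda>x. G (f x)) \<in> borel_measurable borel"
    by (rule borel_measurable_continuous_onI)
  show ?thesis
  proof (rule Bochner_Integration.integrable_bound)
    show "integrable lborel (\<lambda>x. B * norm (f x - l))"
      using f by simp
    show "AE x in lborel. norm (G (f x) - G l) \<le> norm (B * norm (f x - l))"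
      by (intro AE_I2 order_trans[OF lipschitz]) simp
  qed simp
qed

end

subsection \<open>Perturbations with compact support\<close>

lemma
  fixes f :: "'a::euclidean_space \<Rightarrow> 'b::euclidean_space"
  assumes "compact K" "continuous_on K f" "\<And>x. x \<notin> K \<Longrightarrow> f x = 0"
  shows integrable_compact_support: "integrable lborel f"
    and LINT_compact_support: "(LINT x|lborel. f x) = integral K f"
proof -
  have restrict: "f = (\<lambda>x. indicator K x *\<^sub>R f x)"
    using assms(3) by (force simp: indicator_def)
  have K: "set_integrable lborel K f"
    unfolding set_integrable_def using assms(1,2) by (rule borel_integrable_compact)
  then show "integrable lborel f"
    unfolding set_integrable_def by (subst restrict)
  show "(LINT x|lborel. f x) = integral K f"
    using set_borel_integral_eq_integral(2)[OF K] unfolding set_lebesgue_integral_def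
    by (subst restrict)
qed

lemma bounded_range_compact_support:
  fixes f :: "'a::topological_space \<Rightarrow> 'b::real_normed_vector"
  assumes "compact K" "continuous_on K f" "\<And>x. x \<notin> K \<Longrightarrow> f x = 0"
  shows "bounded (range f)"
proof (rule bounded_subset)
  show "bounded (insert 0 (f ` K))"
    using assms(1,2) by (simp add: compact_imp_bounded compact_continuous_image)
  show "range f \<subseteq> insert 0 (f ` K)"
    using assms(3) by auto
qed

lemma DERIV_eq_0_off_support:
  assumes "(f has_real_derivative D) (at x)"
    and "closed K" "\<And>x. x \<notin> K \<Longrightarrow> f x = 0" "x \<notin> K"
  shows "D = 0"
proof -
  have "((\<lambda>_. 0) has_real_derivative D) (at x)"
    by (rule has_field_derivative_transform_within_open[OF assms(1), of "- K"])
       (use assms(2-4) in auto)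
  then show ?thesis
    using DERIV_unique DERIV_const by blast
qed

lemma LINT_deriv_compact_support:
  fixes f f' :: "real \<Rightarrow> real"
  assumes f: "\<And>x. (f has_real_derivative f' x) (at x)" "continuous_on UNIV f'"
    and K: "compact K" "\<And>x. x \<notin> K \<Longrightarrow> f x = 0"
  shows "(LINT x|lborel. f' x) = 0"
proof -
  obtain R where R: "K \<subseteq> {-R<..<R}" "0 < R"
    using compact_imp_bounded[OF K(1)] bounded_subset_ballD[of K 0]
    by (auto simp: ball_eq_greaterThanLessThan)
  have "(f' has_integral f R - f (- R)) {-R..R}"
    using R(2) by (intro fundamental_theorem_of_calculus)
      (auto intro: has_field_derivative_at_within[OF f(1)]
        simp: has_real_derivative_iff_has_vector_derivative[symmetric])
  moreover have "f R = 0" "f (- R) = 0"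
    using R by (auto intro!: K(2))
  moreover have "f' x = 0" if "x \<notin> {-R..R}" for x
    using R that by (intro DERIV_eq_0_off_support[OF f(1) compact_imp_closed[OF K(1)] K(2)]) auto
  then have "(LINT x|lborel. f' x) = integral {-R..R} f'"
    by (intro LINT_compact_support continuous_on_subset[OF f(2)]) auto
  ultimately show ?thesis
    by (simp add: integral_unique)
qed

lemma LINT_by_parts_compact_support:
  fixes p p' h h' :: "real \<Rightarrow> real"
  assumes p: "\<And>x. (p has_real_derivative p' x) (at x)" "continuous_on UNIV p'"
    and h: "\<And>x. (h has_real_derivative h' x) (at x)" "continuous_on UNIV h'"
    and K: "compact K" "\<And>x. x \<notin> K \<Longrightarrow> h x = 0"
  shows "integrable lborel (\<lambda>x. p x * h' x)" "integrable lborel (\<lambda>x. p' x * h x)"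
    and "(LINT x|lborel. p x * h' x) = - (LINT x|lborel. p' x * h x)"
proof -
  have cont: "continuous_on UNIV p" "continuous_on UNIV h"
    by (rule DERIV_continuous_on[OF p(1)] DERIV_continuous_on[OF h(1)])+
  have h'_outside: "h' x = 0" if "x \<notin> K" for x
    by (rule DERIV_eq_0_off_support[OF h(1) compact_imp_closed[OF K(1)] K(2) that])
  have product: "integrable lborel (\<lambda>x. f x * g x)"
    if "continuous_on UNIV f" "continuous_on UNIV g" "\<And>x. x \<notin> K \<Longrightarrow> g x = 0"
    for f g :: "real \<Rightarrow> real"
    using that(3) by (intro integrable_compact_support[OF K(1)] continuous_on_mult
        continuous_on_subset[OF that(1)] continuous_on_subset[OF that(2)]) auto
  show int: "integrable lborel (\<lambda>x. p x * h' x)" "integrable lborel (\<lambda>x. p' x * h x)"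
    by (rule product[OF cont(1) h(2) h'_outside] product[OF p(2) cont(2) K(2)]; assumption)+
  have "(LINT x|lborel. p' x * h x + p x * h' x) = 0"
    by (rule LINT_deriv_compact_support[of "\<lambda>x. p x * h x", OF _ _ K(1)])
       (auto intro!: derivative_eq_intros continuous_intros cont p h simp: K(2))
  then show "(LINT x|lborel. p x * h' x) = - (LINT x|lborel. p' x * h x)"
    using int by simp
qed

lemma
  fixes L L' :: "real \<Rightarrow> 'a::euclidean_space \<Rightarrow> real"
  assumes "0 < r"
    and deriv: "\<And>e x. \<bar>e\<bar> < r \<Longrightarrow> ((\<lambda>e. L e x) has_real_derivative L' e x) (at e)"
    and cont': "continuous_on ({-r<..<r} \<times> cbox a b) (\<lambda>(e, x). L' e x)"
    and cont: "\<And>e. \<bar>e\<bar> < r \<Longrightarrow> continuous_on (cbox a b) (L e)"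
    and outside: "\<And>e x. x \<notin> cbox a b \<Longrightarrow> L e x = L 0 x" "\<And>x. x \<notin> cbox a b \<Longrightarrow> L' 0 x = 0"
    and int: "integrable lborel (L 0)"
  shows integrable_compact_variation: "\<bar>e\<bar> < r \<Longrightarrow> integrable lborel (L e)"
    and has_derivative_LINT_compact_variation:
      "((\<lambda>e. LINT x|lborel. L e x) has_real_derivative (LINT x|lborel. L' 0 x)) (at 0)"
proof -
  define D where "D e x = L e x - L 0 x" for e x
  have L: "L e = (\<lambda>x. L 0 x + D e x)" for e
    by (simp add: D_def fun_eq_iff)
  have D: "continuous_on (cbox a b) (D e)" if "\<bar>e\<bar> < r" for e
    unfolding D_def using that \<open>0 < r\<close> by (intro continuous_intros cont) simp_all
  have D_outside: "D e x = 0" if "x \<notin> cbox a b" for e x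
    using outside(1)[OF that, of e] by (simp add: D_def)
  have D_int: "integrable lborel (D e)" if "\<bar>e\<bar> < r" for e
    by (rule integrable_compact_support[OF compact_cbox D[OF that] D_outside])
  show "integrable lborel (L e)" if "\<bar>e\<bar> < r" for e
    by (subst L) (intro Bochner_Integration.integrable_add int D_int that)
  have "((\<lambda>e. integral (cbox a b) (D e)) has_real_derivative integral (cbox a b) (L' 0))
      (at 0 within {-r<..<r})"
  proof (rule leibniz_rule_field_derivative[OF _ _ cont'])
    fix e x assume "e \<in> {-r<..<r}"
    then show "((\<lambda>e. D e x) has_real_derivative L' e x) (at e within {-r<..<r})"
      unfolding D_def
      by (auto intro!: derivative_eq_intros has_field_derivative_at_within[OF deriv])
  qed (use \<open>0 < r\<close> in \<open>auto intro!: integrable_continuous D\<close>)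
  then have "((\<lambda>e. (LINT x|lborel. L 0 x) + integral (cbox a b) (D e)) has_real_derivative
      integral (cbox a b) (L' 0)) (at 0)"
    using \<open>0 < r\<close> by (auto intro!: derivative_eq_intros simp: at_within_open[of _ "{-r<..<r}"])
  moreover have "integral (cbox a b) (L' 0) = (LINT x|lborel. L' 0 x)"
  proof (rule LINT_compact_support[symmetric])
    show "continuous_on (cbox a b) (L' 0)"
      using \<open>0 < r\<close>
      by (intro continuous_on_compose2[OF cont', of _ "Pair 0", simplified] continuous_intros) auto
  qed (simp_all add: outside)
  moreover have "(LINT x|lborel. L 0 x) + integral (cbox a b) (D e) = (LINT x|lborel. L e x)"
    if "\<bar>e\<bar> < r" for e
    using int D_int[OF that] LINT_compact_support[OF compact_cbox D[OF that] D_outside]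
    by (simp add: L[of e])
  then have "\<forall>\<^sub>F e in nhds 0.
      (LINT x|lborel. L 0 x) + integral (cbox a b) (D e) = (LINT x|lborel. L e x)"
    using eventually_nhds_in_open[of "{-r<..<r}" 0] \<open>0 < r\<close>
    by (auto elim!: eventually_mono)
  ultimately show "((\<lambda>e. LINT x|lborel. L e x) has_real_derivative (LINT x|lborel. L' 0 x)) (at 0)"
    using DERIV_cong_ev[OF refl _ refl] by force
qed

lemma eventually_perturbation_in_open:
  fixes m h :: "'a::topological_space \<Rightarrow> real"
  assumes "open U" "\<And>x. m x \<in> U" "compact K" "continuous_on K m"
    and h: "continuous_on K h" "\<And>x. x \<notin> K \<Longrightarrow> h x = 0"
  shows "\<forall>\<^sub>F e in nhds 0. \<forall>x. m x + e * h x \<in> U"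
proof -
  have "m ` K \<subseteq> U"
    using assms(2) by blast
  then obtain d where d: "0 < d" "(\<Union>y\<in>m ` K. ball y d) \<subseteq> U"
    using compact_subset_open_imp_ball_epsilon_subset compact_continuous_image assms(1,3,4)
    by metis
  obtain B where B: "0 < B" "\<And>x. \<bar>h x\<bar> \<le> B"
    using bounded_range_compact_support[OF \<open>compact K\<close> h] by (auto simp: bounded_pos)
  have "m x + e * h x \<in> U" if e: "\<bar>e\<bar> < d / B" for e x
  proof (cases "x \<in> K")
    case True
    have "\<bar>e * h x\<bar> \<le> \<bar>e\<bar> * B"
      unfolding abs_mult by (intro mult_left_mono B) simp
    also have "\<dots> < d"
      using e B by (simp add: field_simps)
    finally have "m x + e * h x \<in> ball (m x) d"
      by (simp add: dist_real_def)
    then show ?thesis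
      using d True by blast
  qed (use h assms(2) in simp)
  then show ?thesis
    using d B unfolding eventually_nhds_metric
    by (auto simp: dist_real_def intro: exI[of _ "d / B"])
qed

subsection \<open>Variational derivatives\<close>

lemma smooth_has_derivative:
  assumes "smooth f"
  shows "((deriv ^^ n) f has_real_derivative (deriv ^^ Suc n) f x) (at x)"
  using assms unfolding smooth_def
  by (simp add: differentiable_on_def DERIV_deriv_iff_real_differentiable)

lemma smooth_deriv_continuous:
  assumes "smooth f"
  shows "continuous_on A ((deriv ^^ n) f)"
  by (intro continuous_at_imp_continuous_on ballI DERIV_isCont[OF smooth_has_derivative[OF assms]])

lemma smooth_momentum:
  assumes "smooth f"
  shows "smooth (momentum f)"
proof -
  have "(deriv ^^ n) (momentum f) = (\<lambda>x. (deriv ^^ n) f x - (deriv ^^ Suc (Suc n)) f x)" for n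
  proof (induction n)
    case (Suc n)
    have "deriv (\<lambda>x. (deriv ^^ n) f x - (deriv ^^ Suc (Suc n)) f x) x
        = (deriv ^^ Suc n) f x - (deriv ^^ Suc (Suc (Suc n))) f x" for x
      by (intro DERIV_imp_deriv DERIV_diff smooth_has_derivative assms)
    then show ?case
      unfolding funpow.simps(2)[of n deriv] o_apply Suc by (intro ext)
  qed (simp add: momentum_def fun_eq_iff)
  then show ?thesis
    using assms unfolding smooth_def by (auto intro!: differentiable_on_diff simp del: funpow.simps)
qed

lemma test_function_has_derivative:
  assumes "test_function h"
  shows "(h has_real_derivative deriv h x) (at x)"
  using assms smooth_has_derivative[of h 0] by (simp add: test_function_def)

lemma continuous_on_test_function:
  assumes "test_function h"
  shows "continuous_on A h" "continuous_on A (deriv h)"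
  using assms smooth_deriv_continuous[of h A 0] smooth_deriv_continuous[of h A 1]
  by (simp_all add: test_function_def)

lemma test_function_supportE:
  assumes "test_function h"
  obtains a b where "\<And>x. x \<notin> {a..b} \<Longrightarrow> h x = 0"
proof -
  have "bounded {x. h x \<noteq> 0}"
    using assms unfolding test_function_def
    by (auto intro: bounded_subset[OF compact_imp_bounded closure_subset])
  then obtain a where "\<And>x. h x \<noteq> 0 \<Longrightarrow> x \<in> {-a..a}"
    by (auto simp: bounded_iff abs_le_iff minus_le_iff)
  then show thesis
    by (intro that[of "-a" a]) blast
qed

lemma has_variational_derivative_cmult:
  assumes "has_variational_derivative D L m g"
  shows "has_variational_derivative D (\<lambda>m. c * L m) m (\<lambda>x. c * g x)"
  using assms unfolding has_variational_derivative_def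
  by (auto simp: mult.assoc intro!: DERIV_cmult)

lemma has_variational_derivative_add:
  assumes "has_variational_derivative D1 L1 m g1" "has_variational_derivative D2 L2 m g2"
  shows "has_variational_derivative (D1 \<inter> D2) (\<lambda>m. L1 m + L2 m) m (\<lambda>x. g1 x + g2 x)"
  using assms unfolding has_variational_derivative_def
  by (auto simp: distrib_right intro: DERIV_add eventually_conj)

lemma has_variational_derivative_restrict:
  assumes "has_variational_derivative D L m g"
    and "\<And>h. test_function h \<Longrightarrow> \<forall>\<^sub>F e in nhds 0. (\<lambda>x. m x + e * h x) \<in> D'"
  shows "has_variational_derivative (D' \<inter> D) L m g"
  using assms unfolding has_variational_derivative_def by (auto intro: eventually_conj)

locale first_order_lagrangian =
  fixes U :: "real set" and G Gu Gp :: "real \<Rightarrow> real \<Rightarrow> real"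
  assumes open_U: "open U"
    and G: "u \<in> U \<Longrightarrow>
      ((\<lambda>(u, p). G u p) has_derivative (\<lambda>(v, q). Gu u p * v + Gp u p * q)) (at (u, p))"
    and continuous_on_Gu: "continuous_on (U \<times> UNIV) (\<lambda>(u, p). Gu u p)"
    and continuous_on_Gp: "continuous_on (U \<times> UNIV) (\<lambda>(u, p). Gp u p)"
begin

lemma DERIV_along_line:
  assumes "u + e * v \<in> U"
  shows "((\<lambda>e. G (u + e * v) (p + e * q)) has_real_derivative
    Gu (u + e * v) (p + e * q) * v + Gp (u + e * v) (p + e * q) * q) (at e)"
proof -
  have "((\<lambda>e. (u + e * v, p + e * q)) has_derivative (\<lambda>t. (t * v, t * q))) (at e)"
    by (auto intro!: derivative_eq_intros)
  from has_derivative_compose[OF this G[OF assms]] show ?thesis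
    by (auto simp: has_field_derivative_def algebra_simps elim!: has_derivative_eq_rhs)
qed

lemma continuous_on_lagrangian_comp:
  assumes "continuous_on A u" "continuous_on A p" "u ` A \<subseteq> U"
  shows "continuous_on A (\<lambda>x. G (u x) (p x))" "continuous_on A (\<lambda>x. Gu (u x) (p x))"
    "continuous_on A (\<lambda>x. Gp (u x) (p x))"
proof -
  have "continuous_on (U \<times> UNIV) (\<lambda>(u, p). G u p)"
    by (auto intro!: continuous_at_imp_continuous_on has_derivative_continuous G)
  note comp = this continuous_on_Gu continuous_on_Gp
  show "continuous_on A (\<lambda>x. G (u x) (p x))" "continuous_on A (\<lambda>x. Gu (u x) (p x))"
    "continuous_on A (\<lambda>x. Gp (u x) (p x))"
    using assms
    by (auto intro!: continuous_intros
        comp[THEN continuous_on_compose2, of _ "\<lambda>x. (u x, p x)", simplified])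
qed

lemma continuous_on_first_variation:
  fixes m m' h h' :: "real \<Rightarrow> real"
  assumes m: "continuous_on UNIV m" "continuous_on UNIV m'"
    and h: "continuous_on UNIV h" "continuous_on UNIV h'"
    and U: "\<And>e x. e \<in> I \<Longrightarrow> m x + e * h x \<in> U"
  shows "continuous_on (I \<times> K) (\<lambda>(e, x). Gu (m x + e * h x) (m' x + e * h' x) * h x
    + Gp (m x + e * h x) (m' x + e * h' x) * h' x)"
proof -
  have line: "continuous_on (I \<times> K) (\<lambda>z. f (snd z) + fst z * g (snd z))"
    if "continuous_on UNIV f" "continuous_on UNIV g" for f g :: "real \<Rightarrow> real"
    by (intro continuous_intros that[THEN continuous_on_compose2]) auto
  have "(\<lambda>z. m (snd z) + fst z * h (snd z)) ` (I \<times> K) \<subseteq> U"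
    by (auto intro!: U)
  then show ?thesis
    unfolding case_prod_unfold
    by (intro continuous_on_add continuous_on_mult continuous_on_lagrangian_comp line m h
        h[THEN continuous_on_compose2] continuous_on_snd continuous_on_id) simp_all
qed

lemma first_variation:
  fixes m m' h h' :: "real \<Rightarrow> real"
  assumes m: "continuous_on UNIV m" "continuous_on UNIV m'" "\<And>x. m x \<in> U"
    and h: "continuous_on UNIV h" "continuous_on UNIV h'"
      "\<And>x. x \<notin> {a..b} \<Longrightarrow> h x = 0" "\<And>x. x \<notin> {a..b} \<Longrightarrow> h' x = 0"
    and int: "integrable lborel (\<lambda>x. G (m x) (m' x))"
  shows "\<forall>\<^sub>F e in nhds 0. integrable lborel (\<lambda>x. G (m x + e * h x) (m' x + e * h' x))"
    and "((\<lambda>e. LINT x|lborel. G (m x + e * h x) (m' x + e * h' x)) has_real_derivative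
      (LINT x|lborel. Gu (m x) (m' x) * h x + Gp (m x) (m' x) * h' x)) (at 0)"
proof -
  have "\<forall>\<^sub>F e in nhds 0. \<forall>x. m x + e * h x \<in> U"
    by (rule eventually_perturbation_in_open[OF open_U m(3) compact_Icc
          continuous_on_subset[OF m(1) subset_UNIV] continuous_on_subset[OF h(1) subset_UNIV] h(3)])
  then obtain r where r: "0 < r" "\<And>e x. \<bar>e\<bar> < r \<Longrightarrow> m x + e * h x \<in> U"
    unfolding eventually_nhds_metric dist_real_def diff_0_right by blast
  define L where "L e x = G (m x + e * h x) (m' x + e * h' x)" for e x
  define L' where "L' e x = Gu (m x + e * h x) (m' x + e * h' x) * h x
      + Gp (m x + e * h x) (m' x + e * h' x) * h' x" for e x
  have deriv: "((\<lambda>e. L e x) has_real_derivative L' e x) (at e)" if "\<bar>e\<bar> < r" for e x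
    unfolding L_def L'_def by (intro DERIV_along_line r(2) that)
  have cont': "continuous_on ({-r<..<r} \<times> cbox a b) (\<lambda>(e, x). L' e x)"
    unfolding L'_def by (intro continuous_on_first_variation m(1,2) h(1,2) r(2)) auto
  have cont: "continuous_on (cbox a b) (L e)" if "\<bar>e\<bar> < r" for e
    unfolding L_def using r(2)[OF that]
    by (intro continuous_on_lagrangian_comp continuous_intros m(1,2)[THEN continuous_on_subset]
        h(1,2)[THEN continuous_on_subset]) auto
  have outside: "L e x = L 0 x" "L' 0 x = 0" if "x \<notin> cbox a b" for e x
    using h that by (simp_all add: L_def L'_def)
  have int0: "integrable lborel (L 0)"
    using int by (simp add: L_def[abs_def])
  note variation = \<open>0 < r\<close> deriv cont' cont outside int0
  have "integrable lborel (L e)" if "\<bar>e\<bar> < r" for e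
    by (rule integrable_compact_variation[OF variation that])
  then show "\<forall>\<^sub>F e in nhds 0. integrable lborel (\<lambda>x. G (m x + e * h x) (m' x + e * h' x))"
    using \<open>0 < r\<close> unfolding L_def eventually_nhds_metric dist_real_def diff_0_right by blast
  show "((\<lambda>e. LINT x|lborel. G (m x + e * h x) (m' x + e * h' x)) has_real_derivative
      (LINT x|lborel. Gu (m x) (m' x) * h x + Gp (m x) (m' x) * h' x)) (at 0)"
    using has_derivative_LINT_compact_variation[OF variation] by (simp add: L_def L'_def)
qed

theorem euler_lagrange:
  assumes m: "\<And>x. (m has_real_derivative m' x) (at x)" "continuous_on UNIV m'" "\<And>x. m x \<in> U"
    and p: "\<And>x. ((\<lambda>x. Gp (m x) (m' x)) has_real_derivative p' x) (at x)" "continuous_on UNIV p'"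
    and int: "integrable lborel (\<lambda>x. G (m x) (m' x))"
  shows "has_variational_derivative {m. integrable lborel (\<lambda>x. G (m x) (deriv m x))}
    (\<lambda>m. LINT x|lborel. G (m x) (deriv m x)) m (\<lambda>x. Gu (m x) (m' x) - p' x)"
  unfolding has_variational_derivative_def
proof (intro allI impI)
  fix h assume test: "test_function h"
  define h' where "h' = deriv h"
  have h: "(h has_real_derivative h' x) (at x)" "continuous_on A h" "continuous_on A h'" for x A
    unfolding h'_def using test_function_has_derivative continuous_on_test_function test by auto
  obtain a b where supp: "\<And>x. x \<notin> {a..b} \<Longrightarrow> h x = 0"
    using test by (rule test_function_supportE) (rule that)
  have supp': "h' x = 0" if "x \<notin> {a..b}" for x
    using DERIV_eq_0_off_support[OF h(1) _ supp that] by simp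
  have cont_m: "continuous_on UNIV m"
    by (rule DERIV_continuous_on[OF m(1)])
  have deriv: "deriv (\<lambda>x. m x + e * h x) = (\<lambda>x. m' x + e * h' x)" for e
    by (intro ext DERIV_imp_deriv) (auto intro!: derivative_eq_intros m h)
  let ?g = "\<lambda>x. Gu (m x) (m' x) - p' x"
  have "continuous_on UNIV (\<lambda>x. Gu (m x) (m' x))"
    using continuous_on_lagrangian_comp(2)[OF cont_m m(2)] m(3) by auto
  then have int_g: "integrable lborel (\<lambda>x. ?g x * h x)"
    by (intro integrable_compact_support[OF compact_Icc, of a b] continuous_intros h(2)
        continuous_on_subset[OF p(2)]) (auto intro: continuous_on_subset simp: supp)
  note parts = LINT_by_parts_compact_support[OF p h(1,3) compact_Icc supp]
  have "Gu (m x) (m' x) * h x + Gp (m x) (m' x) * h' x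
      = (?g x * h x + p' x * h x) + Gp (m x) (m' x) * h' x" for x
    by (simp add: algebra_simps)
  then have "(LINT x|lborel. Gu (m x) (m' x) * h x + Gp (m x) (m' x) * h' x)
      = (LINT x|lborel. ?g x * h x)"
    using int_g parts by simp
  with first_variation[OF cont_m m(2,3) h(2,3) supp supp' int] int_g
  show "(\<forall>\<^sub>F e in nhds 0. (\<lambda>x. m x + e * h x) \<in> {m. integrable lborel (\<lambda>x. G (m x) (deriv m x))}) \<and>
      integrable lborel (\<lambda>x. ?g x * h x) \<and>
      ((\<lambda>e. LINT x|lborel. G (m x + e * h x) (deriv (\<lambda>x. m x + e * h x) x)) has_real_derivative
        (LINT x|lborel. ?g x * h x)) (at 0)"
    by (simp add: deriv)
qed

end

subsection \<open>The inverse of the Helmholtz operator\<close>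

abbreviation helmholtz_kernel :: "real \<Rightarrow> real \<Rightarrow> real" where
  "helmholtz_kernel x y \<equiv> exp (- \<bar>x - y\<bar>) / 2"

lemma integrable_exp_minus_abs:
  fixes \<gamma> :: real
  assumes "0 < \<gamma>"
  shows "integrable lborel (\<lambda>x. exp (- \<gamma> * \<bar>x\<bar>))"
proof -
  have "set_integrable lebesgue {0..} (\<lambda>x. exp (- \<gamma> * x))"
    using integrable_on_exp_minus_to_infinity[OF assms]
    by (intro nonnegative_absolutely_integrable_1) auto
  also have "?this \<longleftrightarrow> integrable lebesgue (\<lambda>x. indicator {0..} x *\<^sub>R exp (- \<gamma> * \<bar>x\<bar>))"
    unfolding set_integrable_def
    by (intro Bochner_Integration.integrable_cong) (auto simp: indicator_def)
  finally have "integrable lborel (\<lambda>x. indicator {0..} x *\<^sub>R exp (- \<gamma> * \<bar>x\<bar>))"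
    by (subst (asm) integrable_completion) auto
  from has_bochner_integral_even_function[OF has_bochner_integral_integrable[OF this]]
  show ?thesis
    by (auto simp: has_bochner_integral_iff)
qed

lemma integrable_helmholtz_kernel: "integrable lborel (helmholtz_kernel x)"
  using lborel_integrable_real_affine[OF integrable_exp_minus_abs[of 1], of "-1" x] by simp

lemma LINT_helmholtz_kernel:
  "(LINT y|lborel. helmholtz_kernel x y) = (LINT y|lborel. helmholtz_kernel 0 y)"
  using lborel_integral_real_affine[of "-1" "helmholtz_kernel 0" x] by (simp add: abs_minus_commute)

lemma integrable_helmholtz_kernel_mult:
  assumes "f \<in> borel_measurable borel" "bounded (range f)"
  shows "integrable lborel (\<lambda>y. helmholtz_kernel x y * f y)"
  using integrable_bounded_mult[OF integrable_helmholtz_kernel, of f] assms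
  by (simp add: mult.commute)

lemma borel_measurable_helmholtz_inv [measurable]:
  assumes [measurable]: "f \<in> borel_measurable borel"
  shows "helmholtz_inv f \<in> borel_measurable borel"
  unfolding helmholtz_inv_def by measurable

lemma bounded_helmholtz_inv:
  assumes f: "f \<in> borel_measurable borel" "bounded (range f)"
  shows "bounded (range (helmholtz_inv f))"
proof -
  obtain B where B: "\<And>x. \<bar>f x\<bar> \<le> B"
    using f(2) by (auto simp: bounded_iff)
  define C where "C = (LINT y|lborel. helmholtz_kernel 0 y) * B"
  have "\<bar>helmholtz_inv f x\<bar> \<le> C" for x
  proof -
    have "\<bar>helmholtz_inv f x\<bar> \<le> (LINT y|lborel. helmholtz_kernel x y * B)"
      unfolding helmholtz_inv_def
    proof (rule integral_abs_bound_integral)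
      show "integrable lborel (\<lambda>y. helmholtz_kernel x y * f y)"
        by (rule integrable_helmholtz_kernel_mult[OF f])
      show "integrable lborel (\<lambda>y. helmholtz_kernel x y * B)"
        by (rule integrable_mult_left[OF integrable_helmholtz_kernel])
    qed (use B in \<open>simp add: abs_mult\<close>)
    then show ?thesis
      by (simp only: C_def LINT_helmholtz_kernel[of x] integral_mult_left_zero)
  qed
  then show ?thesis
    by (auto simp: bounded_iff)
qed

lemma helmholtz_inv_add_cmult:
  assumes "f \<in> borel_measurable borel" "bounded (range f)"
    and "g \<in> borel_measurable borel" "bounded (range g)"
  shows "helmholtz_inv (\<lambda>y. f y + e * g y) x = helmholtz_inv f x + e * helmholtz_inv g x"
proof -
  have "helmholtz_inv (\<lambda>y. f y + e * g y) x
      = (LINT y|lborel. helmholtz_kernel x y * f y + e * (helmholtz_kernel x y * g y))"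
    by (simp only: helmholtz_inv_def distrib_left mult.left_commute[of _ e])
  also have "\<dots> = helmholtz_inv f x + e * helmholtz_inv g x"
    unfolding helmholtz_inv_def
    using integrable_helmholtz_kernel_mult[OF assms(1,2)]
      integrable_helmholtz_kernel_mult[OF assms(3,4)]
    by (simp only: Bochner_Integration.integral_add integrable_mult_right integral_mult_right_zero)
  finally show ?thesis .
qed

lemma
  assumes f: "f \<in> borel_measurable borel" "bounded (range f)" and g: "integrable lborel g"
  shows integrable_mult_helmholtz_inv: "integrable lborel (\<lambda>x. f x * helmholtz_inv g x)"
    and helmholtz_inv_symmetric:
      "(LINT x|lborel. f x * helmholtz_inv g x) = (LINT x|lborel. helmholtz_inv f x * g x)"
proof -
  let ?k = "\<lambda>y x. helmholtz_kernel y x * f x * g y"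
  have [measurable]: "f \<in> borel_measurable borel" "g \<in> borel_measurable borel"
    using f g by auto
  have abs_f: "(\<lambda>x. \<bar>f x\<bar>) \<in> borel_measurable borel" "bounded (range (\<lambda>x. \<bar>f x\<bar>))"
    using f by (auto simp: bounded_iff)
  have kernel: "integrable (lborel \<Otimes>\<^sub>M lborel) (\<lambda>(y, x). ?k y x)"
  proof (rule lborel_pair.Fubini_integrable)
    have "(LINT x|lborel. norm (?k y x)) = helmholtz_inv (\<lambda>x. \<bar>f x\<bar>) y * \<bar>g y\<bar>" for y
      by (simp add: helmholtz_inv_def abs_mult)
    moreover have "integrable lborel (\<lambda>y. helmholtz_inv (\<lambda>x. \<bar>f x\<bar>) y * \<bar>g y\<bar>)"
      using abs_f g by (intro integrable_bounded_mult bounded_helmholtz_inv) auto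
    ultimately show "integrable lborel (\<lambda>y. LINT x|lborel. norm (case (y, x) of (y, x) \<Rightarrow> ?k y x))"
      by simp
    show "AE y in lborel. integrable lborel (\<lambda>x. case (y, x) of (y, x) \<Rightarrow> ?k y x)"
      unfolding prod.case by (intro AE_I2 integrable_mult_left integrable_helmholtz_kernel_mult f)
  qed measurable
  have inner: "(LINT y|lborel. ?k y x) = f x * helmholtz_inv g x" for x
  proof -
    have "?k y x = f x * (helmholtz_kernel x y * g y)" for y
      by (simp add: abs_minus_commute)
    then show ?thesis
      by (simp only: helmholtz_inv_def integral_mult_right_zero)
  qed
  show "integrable lborel (\<lambda>x. f x * helmholtz_inv g x)"
    using lborel_pair.integrable_snd[OF kernel] by (simp only: inner)
  have "(LINT x|lborel. f x * helmholtz_inv g x) = (LINT y|lborel. LINT x|lborel. ?k y x)"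
    using lborel_pair.Fubini_integral[OF kernel] by (simp only: inner)
  also have "\<dots> = (LINT y|lborel. helmholtz_inv f y * g y)"
    by (simp add: helmholtz_inv_def)
  finally show
    "(LINT x|lborel. f x * helmholtz_inv g x) = (LINT x|lborel. helmholtz_inv f x * g x)" .
qed

lemma DERIV_reflect:
  fixes f :: "real \<Rightarrow> real"
  assumes "\<And>x. (f has_real_derivative f' x) (at x)"
  shows "((\<lambda>x. f (- x)) has_real_derivative - f' (- x)) (at x)"
    and "((\<lambda>x. - f (- x)) has_real_derivative f' (- x)) (at x)"
proof -
  show "((\<lambda>x. f (- x)) has_real_derivative - f' (- x)) (at x)"
    using assms[of "- x"] by (simp add: DERIV_mirror)
  from DERIV_minus[OF this] show "((\<lambda>x. - f (- x)) has_real_derivative f' (- x)) (at x)"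
    by simp
qed

lemma tendsto_0_exp_diff_mult_bounded:
  fixes g :: "real \<Rightarrow> real"
  assumes "bounded (range g)"
  shows "((\<lambda>y. exp (x - y) * g y) \<longlongrightarrow> 0) at_top"
proof -
  obtain B where B: "\<And>y. norm (g y) \<le> B"
    using assms by (auto simp: bounded_iff)
  have "filterlim (\<lambda>y. - x + y) at_top at_top"
    by (intro filterlim_tendsto_add_at_top[OF tendsto_const] filterlim_ident)
  from filterlim_compose[OF exp_at_bot filterlim_compose[OF filterlim_uminus_at_bot_at_top this]]
  have "((\<lambda>y. exp (x - y)) \<longlongrightarrow> 0) at_top"
    by simp
  then show ?thesis
    by (rule lim_null_mult_right_bounded[OF _ always_eventually]) (use B in blast)
qed

lemma LBINT_helmholtz_kernel_right:
  fixes f f' f'' :: "real \<Rightarrow> real"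
  assumes f: "\<And>x. (f has_real_derivative f' x) (at x)" "\<And>x. (f' has_real_derivative f'' x) (at x)"
    and cont: "continuous_on UNIV f''"
    and bounded: "bounded (range f)" "bounded (range f')"
    and int: "integrable lborel (\<lambda>y. helmholtz_kernel x y * (f y - f'' y))"
  shows "(LBINT y=x..\<infinity>. helmholtz_kernel x y * (f y - f'' y)) = (f x + f' x) / 2"
proof -
  let ?F = "\<lambda>y. exp (x - y) * (- (1 / 2) * (f y + f' y))"
  have isCont: "isCont f y" "isCont f' y" "isCont f'' y" for y
    using DERIV_isCont[OF f(1)] DERIV_isCont[OF f(2)] cont
    by (auto simp: continuous_on_eq_continuous_at)
  have "(LBINT y=x..\<infinity>. helmholtz_kernel x y * (f y - f'' y)) = 0 - - (1 / 2) * (f x + f' x)"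
  proof (rule interval_integral_FTC_integrable)
    fix y :: real assume "ereal x < ereal y"
    then have "helmholtz_kernel x y = exp (x - y) / 2"
      by simp
    moreover have "(?F has_real_derivative exp (x - y) / 2 * (f y - f'' y)) (at y)"
      by (auto intro!: derivative_eq_intros f simp: field_simps)
    ultimately show "(?F has_vector_derivative helmholtz_kernel x y * (f y - f'' y)) (at y)"
      by (simp only: has_real_derivative_iff_has_vector_derivative)
  next
    have "(?F \<longlongrightarrow> exp (x - x) * (- (1 / 2) * (f x + f' x))) (at_right x)"
      using isCont by (intro tendsto_intros) (auto simp: isCont_def filterlim_at_split)
    then show "((?F \<circ> real_of_ereal) \<longlongrightarrow> - (1 / 2) * (f x + f' x)) (at_right (ereal x))"
      by (simp add: ereal_tendsto_simps)
    have "bounded (range (\<lambda>y. - (1 / 2) * (f y + f' y)))"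
      using bounded_scaleR_comp[OF bounded_plus_comp[OF bounded], of "- (1 / 2)"]
      by (simp only: real_scaleR_def)
    then have "(?F \<longlongrightarrow> 0) at_top"
      by (rule tendsto_0_exp_diff_mult_bounded)
    then show "((?F \<circ> real_of_ereal) \<longlongrightarrow> 0) (at_left \<infinity>)"
      by (simp add: ereal_tendsto_simps)
    show "set_integrable lborel (einterval (ereal x) \<infinity>) (\<lambda>y. helmholtz_kernel x y * (f y - f'' y))"
      unfolding set_integrable_def by (intro integrable_mult_indicator int) simp
  qed (auto intro!: continuous_intros isCont)
  then show ?thesis
    by simp
qed

lemma LBINT_helmholtz_kernel_left:
  fixes f f' f'' :: "real \<Rightarrow> real"
  assumes f: "\<And>x. (f has_real_derivative f' x) (at x)" "\<And>x. (f' has_real_derivative f'' x) (at x)"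
    and cont: "continuous_on UNIV f''"
    and bounded: "bounded (range f)" "bounded (range f')"
    and int: "integrable lborel (\<lambda>y. helmholtz_kernel x y * (f y - f'' y))"
  shows "(LBINT y=-\<infinity>..x. helmholtz_kernel x y * (f y - f'' y)) = (f x - f' x) / 2"
proof -
  have "(LBINT y=-\<infinity>..x. helmholtz_kernel x y * (f y - f'' y))
      = (LBINT y=-x..\<infinity>. helmholtz_kernel (- x) y * (f (- y) - f'' (- y)))"
    by (subst interval_integral_reflect) (simp add: abs_minus_commute add.commute)
  also have "\<dots> = (f (- (- x)) + - f' (- (- x))) / 2"
  proof (rule LBINT_helmholtz_kernel_right)
    show "((\<lambda>y. f (- y)) has_real_derivative - f' (- y)) (at y)"
      and "((\<lambda>y. - f' (- y)) has_real_derivative f'' (- y)) (at y)" for y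
      by (rule DERIV_reflect(1)[OF f(1)] DERIV_reflect(2)[OF f(2)])+
    show "continuous_on UNIV (\<lambda>y. f'' (- y))"
      by (intro continuous_on_compose2[OF cont] continuous_intros) auto
    show "bounded (range (\<lambda>y. f (- y)))" "bounded (range (\<lambda>y. - f' (- y)))"
      using bounded by (auto simp: bounded_iff)
    show "integrable lborel (\<lambda>y. helmholtz_kernel (- x) y * (f (- y) - f'' (- y)))"
      using lborel_integrable_real_affine[OF int, of "-1" 0]
      by (simp add: abs_minus_commute add.commute)
  qed
  finally show ?thesis
    by simp
qed

lemma helmholtz_inv_inverse:
  fixes f f' f'' :: "real \<Rightarrow> real"
  assumes f: "\<And>x. (f has_real_derivative f' x) (at x)" "\<And>x. (f' has_real_derivative f'' x) (at x)"
    and cont: "continuous_on UNIV f''"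
    and bounded: "bounded (range f)" "bounded (range f')" "bounded (range f'')"
  shows "helmholtz_inv (\<lambda>x. f x - f'' x) x = f x"
proof -
  have "continuous_on UNIV f"
    by (rule DERIV_continuous_on[OF f(1)])
  then have int: "integrable lborel (\<lambda>y. helmholtz_kernel x y * (f y - f'' y))"
    by (intro integrable_helmholtz_kernel_mult borel_measurable_continuous_onI continuous_intros
        cont bounded_minus_comp bounded)
  have "helmholtz_inv (\<lambda>x. f x - f'' x) x = (LBINT y=-\<infinity>..\<infinity>. helmholtz_kernel x y * (f y - f'' y))"
    by (simp add: helmholtz_inv_def interval_lebesgue_integral_def set_lebesgue_integral_def)
  also have "\<dots> = (LBINT y=-\<infinity>..x. helmholtz_kernel x y * (f y - f'' y))
      + (LBINT y=x..\<infinity>. helmholtz_kernel x y * (f y - f'' y))"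
    using int by (intro interval_integral_sum[symmetric])
      (simp add: interval_lebesgue_integrable_def set_integrable_def)
  finally show ?thesis
    unfolding LBINT_helmholtz_kernel_left[OF f cont bounded(1,2) int]
      LBINT_helmholtz_kernel_right[OF f cont bounded(1,2) int] by (simp add: field_simps)
qed

subsection \<open>The first variation of the action\<close>

lemma energy_has_variational_derivative:
  assumes m: "m \<in> borel_measurable borel" "bounded (range m)"
    and int: "integrable lborel (energy_density k m)"
  shows "has_variational_derivative {m. integrable lborel (energy_density k m)} (energy k) m
    (\<lambda>x. 2 * helmholtz_inv m x)"
  unfolding has_variational_derivative_def
proof (intro allI impI)
  fix h assume test: "test_function h"
  then obtain a b where supp: "\<And>x. x \<notin> {a..b} \<Longrightarrow> h x = 0"
    by (rule test_function_supportE) (rule that)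
  note cont_h = continuous_on_test_function(1)[OF test]
  let ?K = "helmholtz_inv"
  have h: "integrable lborel h" "h \<in> borel_measurable borel" "bounded (range h)"
    by (rule integrable_compact_support[OF compact_Icc cont_h supp]
        borel_measurable_continuous_onI[OF cont_h]
        bounded_range_compact_support[OF compact_Icc cont_h supp]; assumption)+
  note int_m_Kh = integrable_mult_helmholtz_inv[OF m h(1)]
  note int_h_Kh = integrable_mult_helmholtz_inv[OF h(2,3,1)]
  have int_Km_h: "integrable lborel (\<lambda>x. ?K m x * h x)"
    using m by (intro integrable_bounded_mult[OF h(1)] bounded_helmholtz_inv) simp_all
  have density: "energy_density k (\<lambda>x. m x + e * h x) = (\<lambda>x. energy_density k m x
      + e * (m x * ?K h x + ?K m x * h x) + e\<^sup>2 * (h x * ?K h x))" for e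
    by (simp add: fun_eq_iff energy_density_def helmholtz_inv_add_cmult[OF m h(2,3)]
        algebra_simps power2_eq_square)
  have "energy k (\<lambda>x. m x + e * h x) = energy k m
      + e * (2 * (LINT x|lborel. ?K m x * h x)) + e\<^sup>2 * (LINT x|lborel. h x * ?K h x)" for e
    unfolding energy_def density
    using int int_m_Kh int_h_Kh int_Km_h helmholtz_inv_symmetric[OF m h(1)] by simp
  moreover have "((\<lambda>e. p + e * q + e\<^sup>2 * r) has_real_derivative q) (at 0)" for p q r :: real
    by (auto intro!: derivative_eq_intros)
  ultimately have "((\<lambda>e. energy k (\<lambda>x. m x + e * h x)) has_real_derivative
      2 * (LINT x|lborel. ?K m x * h x)) (at 0)"
    by (simp only:)
  then show "(\<forall>\<^sub>F e in nhds 0. (\<lambda>x. m x + e * h x) \<in> {m. integrable lborel (energy_density k m)}) \<and>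
      integrable lborel (\<lambda>x. 2 * ?K m x * h x) \<and>
      ((\<lambda>e. energy k (\<lambda>x. m x + e * h x)) has_real_derivative
        (LINT x|lborel. 2 * ?K m x * h x)) (at 0)"
    using int int_m_Kh int_h_Kh int_Km_h by (simp add: density mult.assoc)
qed

lemma has_derivative_fst_powr:
  fixes u :: real
  assumes "0 < u"
  shows "((\<lambda>z. fst z powr r) has_derivative (\<lambda>z. fst z * (r * u powr (r - 1)))) (at (u, p))"
  using DERIV_compose_FDERIV[OF has_real_derivative_powr[of "fst (u, p)"]
      has_derivative_fst[OF has_derivative_ident]] assms by simp

lemma F1_lagrangian:
  "first_order_lagrangian {0<..} (\<lambda>u p. u powr (2/3) - k powr (2/3))
    (\<lambda>u p. 2/3 * u powr (-1/3)) (\<lambda>u p. 0)"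
proof
  fix u p :: real assume "u \<in> {0<..}"
  then show "((\<lambda>(u, p). u powr (2/3) - k powr (2/3)) has_derivative
      (\<lambda>(v, q). 2/3 * u powr (-1/3) * v + 0 * q)) (at (u, p))"
    unfolding case_prod_unfold
    by (auto intro!: derivative_eq_intros has_derivative_fst_powr[THEN has_derivative_eq_rhs])
qed (auto intro!: continuous_intros simp: case_prod_unfold)

lemma F2_lagrangian:
  "first_order_lagrangian {0<..} (\<lambda>u p. u powr (-8/3) * p\<^sup>2 + 9 * (u powr (-2/3) - k powr (-2/3)))
    (\<lambda>u p. -8/3 * u powr (-11/3) * p\<^sup>2 - 6 * u powr (-5/3)) (\<lambda>u p. 2 * u powr (-8/3) * p)"
proof
  fix u p :: real assume "u \<in> {0<..}"
  then show "((\<lambda>(u, p). u powr (-8/3) * p\<^sup>2 + 9 * (u powr (-2/3) - k powr (-2/3))) has_derivative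
      (\<lambda>(v, q). (-8/3 * u powr (-11/3) * p\<^sup>2 - 6 * u powr (-5/3)) * v + 2 * u powr (-8/3) * p * q))
      (at (u, p))"
    unfolding case_prod_unfold
    by (auto intro!: derivative_eq_intros has_derivative_fst_powr[THEN has_derivative_eq_rhs]
        simp: algebra_simps)
qed (auto intro!: continuous_intros simp: case_prod_unfold)

lemma sobolev_H1I:
  assumes f: "\<And>x. (f has_real_derivative f' x) (at x)" "continuous_on UNIV f'"
    and int: "integrable lborel (\<lambda>x. (f x)\<^sup>2)" "integrable lborel (\<lambda>x. (f' x)\<^sup>2)"
  shows "f \<in> sobolev_H1"
proof -
  have deriv: "deriv f = f'"
    by (intro ext DERIV_imp_deriv f)
  have f': "set_integrable lborel {a..b} f'" for a b
    by (intro borel_integrable_atLeastAtMost' continuous_on_subset[OF f(2)]) auto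
  have "f b - f a = (LINT x:{a..b}|lborel. f' x)" if "a \<le> b" for a b
  proof -
    have "(f' has_integral f b - f a) {a..b}"
      using that f(1) by (intro fundamental_theorem_of_calculus)
        (auto simp: has_real_derivative_iff_has_vector_derivative[symmetric]
          intro: has_field_derivative_at_within)
    then show ?thesis
      using set_borel_integral_eq_integral(2)[OF f'] by (metis integral_unique)
  qed
  with f' int show ?thesis
    by (auto simp: sobolev_H1_def deriv)
qed

lemma integrable_power2_add:
  fixes f g :: "'a \<Rightarrow> real"
  assumes [measurable]: "f \<in> borel_measurable M" "g \<in> borel_measurable M"
    and int: "integrable M (\<lambda>x. (f x)\<^sup>2)" "integrable M (\<lambda>x. (g x)\<^sup>2)"
  shows "integrable M (\<lambda>x. (f x + g x)\<^sup>2)"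
proof (rule Bochner_Integration.integrable_bound)
  show "integrable M (\<lambda>x. 2 * (f x)\<^sup>2 + 2 * (g x)\<^sup>2)"
    using int by simp
  have "(f x + g x)\<^sup>2 \<le> 2 * (f x)\<^sup>2 + 2 * (g x)\<^sup>2" for x
    using zero_le_power2[of "f x - g x"] by (simp add: power2_sum power2_diff)
  then show "AE x in M. norm ((f x + g x)\<^sup>2) \<le> norm (2 * (f x)\<^sup>2 + 2 * (g x)\<^sup>2)"
    by simp
qed measurable

lemma sobolev_H1_add_test_function:
  assumes f: "f \<in> sobolev_H1" "\<And>x. (f has_real_derivative f' x) (at x)" "continuous_on UNIV f'"
    and test: "test_function h"
  shows "(\<lambda>x. f x + e * h x) \<in> sobolev_H1"
proof (rule sobolev_H1I)
  note cont_h = continuous_on_test_function[OF test]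
  have DERIV_h: "(h has_real_derivative deriv h x) (at x)" for x
    by (rule test_function_has_derivative[OF test])
  obtain a b where supp: "\<And>x. x \<notin> {a..b} \<Longrightarrow> h x = 0"
    using test by (rule test_function_supportE) (rule that)
  have supp': "deriv h x = 0" if "x \<notin> {a..b}" for x
    using DERIV_eq_0_off_support[OF DERIV_h _ supp that] by simp
  have "continuous_on UNIV f"
    by (rule DERIV_continuous_on[OF f(2)])
  then have [measurable]: "f \<in> borel_measurable borel" "f' \<in> borel_measurable borel"
    "h \<in> borel_measurable borel" "deriv h \<in> borel_measurable borel"
    by (intro borel_measurable_continuous_onI f cont_h; assumption)+
  have square: "integrable lborel (\<lambda>x. (e * g x)\<^sup>2)"
    if "continuous_on {a..b} g" "\<And>x. x \<notin> {a..b} \<Longrightarrow> g x = 0" for g :: "real \<Rightarrow> real"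
    using that by (intro integrable_compact_support[OF compact_Icc[of a b]] continuous_intros) auto
  have "deriv f = f'"
    by (intro ext DERIV_imp_deriv f)
  then have L2: "integrable lborel (\<lambda>x. (f x)\<^sup>2)" "integrable lborel (\<lambda>x. (f' x)\<^sup>2)"
    using f(1) by (auto simp only: sobolev_H1_def mem_Collect_eq)
  show "((\<lambda>x. f x + e * h x) has_real_derivative f' x + e * deriv h x) (at x)" for x
    by (auto intro!: derivative_eq_intros f DERIV_h)
  show "continuous_on UNIV (\<lambda>x. f' x + e * deriv h x)"
    by (intro continuous_intros f cont_h)
  show "integrable lborel (\<lambda>x. (f x + e * h x)\<^sup>2)"
    by (intro integrable_power2_add L2 square cont_h supp) measurable
  show "integrable lborel (\<lambda>x. (f' x + e * deriv h x)\<^sup>2)"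
    by (intro integrable_power2_add L2 square cont_h supp') measurable
qed

lemma eventually_X_space_variation:
  assumes m: "m \<in> X_space k" "\<And>x. (m has_real_derivative m' x) (at x)" "continuous_on UNIV m'"
    and test: "test_function h"
  shows "\<forall>\<^sub>F e in nhds 0. (\<lambda>x. m x + e * h x) \<in> X_space k"
proof -
  obtain a b where supp: "\<And>x. x \<notin> {a..b} \<Longrightarrow> h x = 0"
    using test by (rule test_function_supportE) (rule that)
  have "continuous_on {a..b} m"
    by (rule continuous_on_subset[OF DERIV_continuous_on[OF m(2)] subset_UNIV])
  moreover have "m x \<in> {0<..}" for x
    using m(1) by (simp add: X_space_def)
  ultimately have "\<forall>\<^sub>F e in nhds 0. \<forall>x. m x + e * h x \<in> {0<..}"
    by (intro eventually_perturbation_in_open[OF open_greaterThan _ compact_Icc _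
          continuous_on_test_function(1)[OF test] supp])
  moreover have "(\<lambda>x. m x - k + e * h x) \<in> sobolev_H1" for e
    using m(1) by (intro sobolev_H1_add_test_function[OF _ _ m(3) test])
      (auto intro!: derivative_eq_intros m(2) simp: X_space_def)
  then have "(\<lambda>x. m x + e * h x) \<in> X_space k" if "\<forall>x. m x + e * h x \<in> {0<..}" for e
    using that by (simp add: X_space_def algebra_simps)
  ultimately show ?thesis
    by (rule eventually_mono)
qed

lemma F1_has_variational_derivative:
  assumes m: "\<And>x. (m has_real_derivative m' x) (at x)" "continuous_on UNIV m'" "\<And>x. 0 < m x"
    and int: "integrable lborel (F1_density k m)"
  shows "has_variational_derivative {m. integrable lborel (F1_density k m)} (F1 k) m
    (\<lambda>x. 2/3 * m x powr (-1/3))"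
proof -
  have "has_variational_derivative {m. integrable lborel (F1_density k m)} (F1 k) m
      (\<lambda>x. 2/3 * m x powr (-1/3) - 0)"
    unfolding F1_def F1_density_def
    by (rule first_order_lagrangian.euler_lagrange[OF F1_lagrangian m(1,2)])
       (use m(3) int in \<open>auto simp: F1_density_def[abs_def]\<close>)
  then show ?thesis
    by simp
qed

lemma F2_has_variational_derivative:
  assumes m: "\<And>x. (m has_real_derivative m' x) (at x)" "\<And>x. (m' has_real_derivative m'' x) (at x)"
      "continuous_on UNIV m''" "\<And>x. 0 < m x"
    and int: "integrable lborel (F2_density k m)"
  shows "has_variational_derivative {m. integrable lborel (F2_density k m)} (F2 k) m
    (\<lambda>x. 8/3 * m x powr (-11/3) * (m' x)\<^sup>2 - 2 * m x powr (-8/3) * m'' x - 6 * m x powr (-5/3))"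
proof -
  have cont: "continuous_on UNIV m" "continuous_on UNIV m'"
    by (rule DERIV_continuous_on[OF m(1)] DERIV_continuous_on[OF m(2)])+
  have "deriv m = m'"
    by (intro ext DERIV_imp_deriv m)
  let ?p' = "\<lambda>x. 2 * m x powr (-8/3) * m'' x - 16/3 * m x powr (-11/3) * (m' x)\<^sup>2"
  have "has_variational_derivative {m. integrable lborel (F2_density k m)} (F2 k) m
      (\<lambda>x. -8/3 * m x powr (-11/3) * (m' x)\<^sup>2 - 6 * m x powr (-5/3) - ?p' x)"
    unfolding F2_def F2_density_def
  proof (rule first_order_lagrangian.euler_lagrange[OF F2_lagrangian m(1) cont(2)])
    show "((\<lambda>x. 2 * m x powr (-8/3) * m' x) has_real_derivative ?p' x) (at x)" for x
      using m(4)[of x] by (auto intro!: derivative_eq_intros m simp: algebra_simps power2_eq_square)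
    show "continuous_on UNIV ?p'"
      using m(4) by (intro continuous_intros cont m(3)) (auto simp: less_imp_neq[symmetric])
    show "integrable lborel
        (\<lambda>x. m x powr (-8/3) * (m' x)\<^sup>2 + 9 * (m x powr (-2/3) - k powr (-2/3)))"
      using int by (simp add: F2_density_def[abs_def] \<open>deriv m = m'\<close>)
  qed (use m(4) in simp)
  then show ?thesis
    by (simp add: algebra_simps)
qed

theorem action_has_variational_derivative:
  assumes domain: "m \<in> action_domain k" and bounded: "bounded (range m)"
    and m: "\<And>x. (m has_real_derivative m' x) (at x)" "\<And>x. (m' has_real_derivative m'' x) (at x)"
      "continuous_on UNIV m''"
  shows "has_variational_derivative (action_domain k) (action k \<omega>0 \<omega>1) m (action_gradient \<omega>0 \<omega>1 m)"
proof -
  have cont: "continuous_on UNIV m" "continuous_on UNIV m'"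
    by (rule DERIV_continuous_on[OF m(1)] DERIV_continuous_on[OF m(2)])+
  have deriv: "deriv m = m'" "deriv m' = m''"
    by (intro ext DERIV_imp_deriv m)+
  have "m \<in> X_space k" and pos: "\<And>x. 0 < m x"
    and int: "integrable lborel (energy_density k m)" "integrable lborel (F1_density k m)"
      "integrable lborel (F2_density k m)"
    using domain by (simp_all add: action_domain_def X_space_def)
  have gradient: "action_gradient \<omega>0 \<omega>1 m =
      (\<lambda>x. \<omega>0 * (2 * helmholtz_inv m x) + \<omega>1 * (2/3 * m x powr (-1/3))
        + (8/3 * m x powr (-11/3) * (m' x)\<^sup>2 - 2 * m x powr (-8/3) * m'' x - 6 * m x powr (-5/3)))"
    by (simp add: fun_eq_iff action_gradient_def deriv powr_minus_divide)
  have "has_variational_derivative (X_space k \<inter> ({m. integrable lborel (energy_density k m)}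
      \<inter> {m. integrable lborel (F1_density k m)} \<inter> {m. integrable lborel (F2_density k m)}))
      (action k \<omega>0 \<omega>1) m (action_gradient \<omega>0 \<omega>1 m)"
    unfolding gradient action_def[abs_def]
    by (intro has_variational_derivative_restrict
          [OF _ eventually_X_space_variation[OF \<open>m \<in> X_space k\<close> m(1) cont(2)]]
        has_variational_derivative_add has_variational_derivative_cmult
        energy_has_variational_derivative borel_measurable_continuous_onI cont(1) bounded
        F1_has_variational_derivative[OF m(1) cont(2)] F2_has_variational_derivative[OF m] pos int)
  then show ?thesis
    by (simp add: action_domain_def Int_def conj_assoc)
qed

lemma DERIV_divide_cube:
  fixes f :: "real \<Rightarrow> real"
  assumes "(f has_real_derivative D) (at x)" "f x \<noteq> 0"
  shows "((\<lambda>x. A / f x ^ 3) has_real_derivative - 3 * A * D / f x ^ 4) (at x)"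
  using assms by (auto intro!: derivative_eq_intros simp: field_simps eval_nat_numeral)

lemma action_gradient_inverse_cube:
  fixes w w' w'' :: "real \<Rightarrow> real"
  assumes w: "\<And>x. (w has_real_derivative w' x) (at x)" "\<And>x. (w' has_real_derivative w'' x) (at x)"
    and pos: "\<And>x. 0 < w x"
  shows "action_gradient \<omega>0 \<omega>1 (\<lambda>x. 1 / w x ^ 3) x
    = 2 * \<omega>0 * helmholtz_inv (\<lambda>x. 1 / w x ^ 3) x + 2 / 3 * \<omega>1 * w x - 6 * w x ^ 4 * (w x - w'' x)"
proof -
  let ?m = "\<lambda>x. 1 / w x ^ 3"
  have [simp]: "w x \<noteq> 0" for x
    using pos[of x] by simp
  have m': "deriv ?m = (\<lambda>x. - 3 * w' x / w x ^ 4)"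
    using DERIV_divide_cube[OF w(1), of _ 1] by (intro ext DERIV_imp_deriv) simp
  have "((\<lambda>x. - 3 * w' x / w x ^ 4) has_real_derivative
      12 * (w' x)\<^sup>2 / w x ^ 5 - 3 * w'' x / w x ^ 4) (at x)" for x
    by (auto intro!: derivative_eq_intros w simp: field_simps eval_nat_numeral)
  then have m'': "deriv (deriv ?m) x = 12 * (w' x)\<^sup>2 / w x ^ 5 - 3 * w'' x / w x ^ 4"
    unfolding m' by (intro DERIV_imp_deriv)
  have "1 / w x ^ 3 = w x powr (- 3)"
    using pos[of x] by (simp add: powr_minus_divide)
  then have powr: "(1 / w x ^ 3) powr p = w x powr (- 3 * p)" for p
    by (simp only: powr_powr)
  have "action_gradient \<omega>0 \<omega>1 ?m x = 2 * \<omega>0 * helmholtz_inv ?m x + 2 * \<omega>1 / (3 * (1 / w x))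
      - 2 * w x ^ 8 * (12 * (w' x)\<^sup>2 / w x ^ 5 - 3 * w'' x / w x ^ 4)
      - 6 * w x ^ 5 + 8 * (- 3 * w' x / w x ^ 4)\<^sup>2 / (3 * (1 / w x ^ 11))"
    unfolding action_gradient_def m'' powr using pos[of x] by (simp add: m' powr_minus_divide)
  also have "\<dots> = 2 * \<omega>0 * helmholtz_inv ?m x + 2 / 3 * \<omega>1 * w x - 6 * w x ^ 4 * (w x - w'' x)"
    by (simp add: field_simps eval_nat_numeral)
  finally show ?thesis .
qed

subsection \<open>Homoclinic orbits of Newton's equation\<close>

lemma derivative_limit_power2_eq_0:
  fixes f :: "real \<Rightarrow> real"
  assumes f: "\<And>x. (f has_real_derivative f' x) (at x)"
    and lim: "(f \<longlongrightarrow> l) at_top" "((\<lambda>x. (f' x)\<^sup>2) \<longlongrightarrow> L) at_top"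
  shows "L = 0"
proof (rule ccontr)
  assume "L \<noteq> 0"
  moreover have "0 \<le> L"
    by (rule tendsto_lowerbound[OF lim(2)]) auto
  ultimately have "0 < L" by simp
  have "filterlim (\<lambda>x. 1 + x) at_top (at_top :: real filter)"
    by (intro filterlim_tendsto_add_at_top[OF tendsto_const] filterlim_ident)
  then have "((\<lambda>x. f (1 + x)) \<longlongrightarrow> l) at_top"
    by (rule filterlim_compose[OF lim(1)])
  then have "((\<lambda>x. (f (1 + x) - f x)\<^sup>2) \<longlongrightarrow> (l - l)\<^sup>2) at_top"
    by (intro tendsto_intros lim(1))
  then have "\<forall>\<^sub>F x in at_top. (f (1 + x) - f x)\<^sup>2 < L / 2"
    by (rule order_tendstoD(2)) (use \<open>0 < L\<close> in simp)
  moreover have "\<forall>\<^sub>F x in at_top. L / 2 < (f' x)\<^sup>2"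
    by (rule order_tendstoD(1)[OF lim(2)]) (use \<open>0 < L\<close> in simp)
  ultimately have "\<forall>\<^sub>F x in at_top. (f (1 + x) - f x)\<^sup>2 < L / 2 \<and> L / 2 < (f' x)\<^sup>2"
    by (rule eventually_conj)
  then obtain X where X: "\<And>x. X \<le> x \<Longrightarrow> (f (1 + x) - f x)\<^sup>2 < L / 2 \<and> L / 2 < (f' x)\<^sup>2"
    unfolding eventually_at_top_linorder by blast
  obtain z where "X < z" "f (1 + X) - f X = f' z"
    using MVT2[of X "1 + X" f f'] f by auto
  then show False
    using X[of X] X[of z] by simp
qed

lemma homoclinic_first_integral:
  fixes v v' :: "real \<Rightarrow> real"
  assumes v: "\<And>x. (v has_real_derivative v' x) (at x)" "\<And>x. (v' has_real_derivative f (v x)) (at x)"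
    and V: "\<And>x. (V has_real_derivative f (v x)) (at (v x))" "isCont V l"
    and lim: "(v \<longlongrightarrow> l) at_top"
  shows "(v' x)\<^sup>2 = 2 * (V (v x) - V l)"
proof -
  define C where "C = (v' 0)\<^sup>2 - 2 * V (v 0)"
  have "((\<lambda>x. (v' x)\<^sup>2 - 2 * V (v x)) has_real_derivative 0) (at x)" for x
    by (auto intro!: derivative_eq_intros v DERIV_chain2[where f = V and g = v, OF V(1) v(1)])
  then have "(v' x)\<^sup>2 - 2 * V (v x) = C" for x
    unfolding C_def using DERIV_isconst_all by blast
  then have v'2: "(v' x)\<^sup>2 = C + 2 * V (v x)" for x
    by (simp add: algebra_simps eq_diff_eq[symmetric])
  have "((\<lambda>x. (v' x)\<^sup>2) \<longlongrightarrow> C + 2 * V l) at_top"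
    unfolding v'2 by (intro tendsto_intros isCont_tendsto_compose[OF V(2) lim])
  then have "C + 2 * V l = 0"
    by (rule derivative_limit_power2_eq_0[OF v(1) lim])
  then show ?thesis
    unfolding v'2 by simp
qed

lemma nonpos_of_DERIV_ge_tendsto_0:
  fixes q q' :: "real \<Rightarrow> real"
  assumes "0 \<le> \<beta>" and q: "\<And>x. X \<le> x \<Longrightarrow> (q has_real_derivative q' x) (at x)"
    and growth: "\<And>x. X \<le> x \<Longrightarrow> \<beta> * q x \<le> q' x"
    and lim: "(q \<longlongrightarrow> 0) at_top" and "X \<le> x"
  shows "q x \<le> 0"
proof -
  let ?g = "\<lambda>x. q x * exp (- \<beta> * x)"
  have "?g x \<le> ?g y" if "x \<le> y" for y
  proof (rule DERIV_nonneg_imp_nondecreasing[OF that])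
    fix z assume "x \<le> z"
    then have "X \<le> z" using \<open>X \<le> x\<close> by simp
    then have "(?g has_real_derivative (q' z - \<beta> * q z) * exp (- \<beta> * z)) (at z)"
      by (auto intro!: derivative_eq_intros q simp: algebra_simps)
    then show "\<exists>d. (?g has_real_derivative d) (at z) \<and> 0 \<le> d"
      using growth[OF \<open>X \<le> z\<close>] by (intro exI conjI) auto
  qed
  then have "\<forall>\<^sub>F y in at_top. ?g x \<le> ?g y"
    by (auto simp: eventually_at_top_linorder)
  moreover have "(?g \<longlongrightarrow> 0) at_top"
  proof (rule lim_null_mult_right_bounded[OF lim])
    show "\<forall>\<^sub>F y in at_top. norm (exp (- \<beta> * y)) \<le> 1"
      using \<open>0 \<le> \<beta>\<close> by (intro eventually_at_top_linorderI[of 0]) simp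
  qed
  ultimately have "?g x \<le> 0"
    by (intro tendsto_lowerbound[of ?g]) auto
  then show ?thesis
    by (simp add: mult_le_0_iff)
qed

text \<open>The function \<open>v' + \<beta> v\<close> grows at rate \<open>\<beta>\<close> and tends to \<open>0\<close>, hence is never positive.\<close>

lemma exponential_decay:
  fixes v v' v'' :: "real \<Rightarrow> real"
  assumes "0 \<le> \<beta>"
    and v: "\<And>x. (v has_real_derivative v' x) (at x)" "\<And>x. (v' has_real_derivative v'' x) (at x)"
    and convex: "\<And>x. X \<le> x \<Longrightarrow> \<beta>\<^sup>2 * v x \<le> v'' x"
    and lim: "(v \<longlongrightarrow> 0) at_top" "(v' \<longlongrightarrow> 0) at_top"
    and "X \<le> x"
  shows "v x \<le> v X * exp (- \<beta> * (x - X))"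
proof -
  have nonpos: "v' y + \<beta> * v y \<le> 0" if "X \<le> y" for y
  proof (rule nonpos_of_DERIV_ge_tendsto_0[OF \<open>0 \<le> \<beta>\<close> _ _ _ that])
    show "((\<lambda>x. v' x + \<beta> * v x) has_real_derivative v'' x + \<beta> * v' x) (at x)" for x
      by (auto intro!: derivative_eq_intros v)
    show "\<beta> * (v' x + \<beta> * v x) \<le> v'' x + \<beta> * v' x" if "X \<le> x" for x
      using convex[OF that] by (simp add: algebra_simps power2_eq_square)
    show "((\<lambda>x. v' x + \<beta> * v x) \<longlongrightarrow> 0) at_top"
      using tendsto_add[OF lim(2) tendsto_mult_left[OF lim(1), of \<beta>]] by simp
  qed
  have "v x * exp (\<beta> * (x - X)) \<le> v X * exp (\<beta> * (X - X))"
  proof (rule DERIV_nonpos_imp_nonincreasing[OF \<open>X \<le> x\<close>])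
    fix y assume "X \<le> y"
    have "((\<lambda>x. v x * exp (\<beta> * (x - X))) has_real_derivative
        (v' y + \<beta> * v y) * exp (\<beta> * (y - X))) (at y)"
      by (auto intro!: derivative_eq_intros v simp: algebra_simps)
    moreover have "(v' y + \<beta> * v y) * exp (\<beta> * (y - X)) \<le> 0"
      using nonpos[OF \<open>X \<le> y\<close>] by (simp add: mult_le_0_iff)
    ultimately show "\<exists>d. ((\<lambda>x. v x * exp (\<beta> * (x - X))) has_real_derivative d) (at y) \<and> d \<le> 0"
      by blast
  qed
  then have "v x \<le> v X / exp (\<beta> * (x - X))"
    by (simp add: pos_le_divide_eq)
  then show ?thesis
    by (simp add: exp_minus divide_inverse)
qed

lemma eventually_power2_le_of_DERIV:
  fixes f :: "real \<Rightarrow> real"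
  assumes f: "(f has_real_derivative \<kappa>) (at l)" "f l = 0" and "\<nu> < \<kappa>"
  shows "\<forall>\<^sub>F t in nhds l. \<nu> * (t - l)\<^sup>2 \<le> (t - l) * f t"
proof -
  have "((\<lambda>t. f t / (t - l)) \<longlongrightarrow> \<kappa>) (at l)"
    using f by (simp add: has_field_derivative_iff)
  then have "\<forall>\<^sub>F t in at l. \<nu> < f t / (t - l)"
    by (rule order_tendstoD(1)) fact
  then have "\<forall>\<^sub>F t in at l. \<nu> * (t - l)\<^sup>2 \<le> (t - l) * f t"
  proof (rule eventually_mono)
    fix t assume "\<nu> < f t / (t - l)"
    then have "\<nu> * (t - l)\<^sup>2 \<le> f t / (t - l) * (t - l)\<^sup>2"
      by (intro mult_right_mono) auto
    also have "\<dots> = (t - l) * f t"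
      by (simp add: power2_eq_square)
    finally show "\<nu> * (t - l)\<^sup>2 \<le> (t - l) * f t" .
  qed
  then show ?thesis
    by (simp add: eventually_nhds_conv_at)
qed

lemma saddle_exponential_decay:
  fixes v v' :: "real \<Rightarrow> real"
  assumes v: "\<And>x. (v has_real_derivative v' x) (at x)" "\<And>x. (v' has_real_derivative f (v x)) (at x)"
    and f: "(f has_real_derivative \<kappa>) (at l)" "f l = 0" "0 < \<kappa>"
    and lim: "(v \<longlongrightarrow> l) at_top" "(v' \<longlongrightarrow> 0) at_top"
  obtains X where "\<And>x. X \<le> x \<Longrightarrow> (v x - l)\<^sup>2 \<le> (v X - l)\<^sup>2 * exp (- sqrt \<kappa> * (x - X))"
proof -
  have "\<forall>\<^sub>F t in nhds l. \<kappa> / 2 * (t - l)\<^sup>2 \<le> (t - l) * f t"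
    using f by (intro eventually_power2_le_of_DERIV) auto
  then have "\<forall>\<^sub>F x in at_top. \<kappa> / 2 * (v x - l)\<^sup>2 \<le> (v x - l) * f (v x)"
    using lim(1) by (rule eventually_compose_filterlim)
  then obtain X where X: "\<And>x. X \<le> x \<Longrightarrow> \<kappa> / 2 * (v x - l)\<^sup>2 \<le> (v x - l) * f (v x)"
    unfolding eventually_at_top_linorder by blast
  have "(v x - l)\<^sup>2 \<le> (v X - l)\<^sup>2 * exp (- sqrt \<kappa> * (x - X))" if "X \<le> x" for x
  proof (rule exponential_decay[OF _ _ _ _ _ _ that])
    show "((\<lambda>x. (v x - l)\<^sup>2) has_real_derivative 2 * (v x - l) * v' x) (at x)" for x
      by (auto intro!: derivative_eq_intros v)
    show "((\<lambda>x. 2 * (v x - l) * v' x) has_real_derivative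
        2 * (v' x)\<^sup>2 + 2 * ((v x - l) * f (v x))) (at x)" for x
      by (auto intro!: derivative_eq_intros v simp: power2_eq_square)
    show "(sqrt \<kappa>)\<^sup>2 * (v x - l)\<^sup>2 \<le> 2 * (v' x)\<^sup>2 + 2 * ((v x - l) * f (v x))" if "X \<le> x" for x
    proof -
      have "(sqrt \<kappa>)\<^sup>2 * (v x - l)\<^sup>2 \<le> 2 * ((v x - l) * f (v x))"
        using X[OF that] f(3) by simp
      then show ?thesis
        using zero_le_power2[of "v' x"] by linarith
    qed
    have "((\<lambda>x. (v x - l)\<^sup>2) \<longlongrightarrow> (l - l)\<^sup>2) at_top"
      by (intro tendsto_intros lim)
    then show "((\<lambda>x. (v x - l)\<^sup>2) \<longlongrightarrow> 0) at_top" by simp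
    have "((\<lambda>x. 2 * (v x - l) * v' x) \<longlongrightarrow> 2 * (l - l) * 0) at_top"
      by (intro tendsto_intros lim)
    then show "((\<lambda>x. 2 * (v x - l) * v' x) \<longlongrightarrow> 0) at_top" by simp
  qed (use f in simp)
  then show thesis
    by (rule that)
qed

lemma abs_le_of_power2_le_exp:
  fixes u v \<gamma> :: real
  assumes "u\<^sup>2 \<le> v\<^sup>2 * exp (- 2 * \<gamma> * (x - X))"
  shows "\<bar>u\<bar> \<le> \<bar>v\<bar> * exp (\<gamma> * X) * exp (- \<gamma> * x)"
proof -
  have "exp (- 2 * \<gamma> * (x - X)) = (exp (\<gamma> * X) * exp (- \<gamma> * x))\<^sup>2"
    by (simp add: algebra_simps flip: exp_double exp_add)
  then have "u\<^sup>2 \<le> (v * (exp (\<gamma> * X) * exp (- \<gamma> * x)))\<^sup>2"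
    using assms by (simp only: power_mult_distrib)
  then have "\<bar>u\<bar> \<le> \<bar>v * (exp (\<gamma> * X) * exp (- \<gamma> * x))\<bar>"
    by (simp only: abs_le_square_iff)
  then show ?thesis
    by (simp add: abs_mult mult.assoc)
qed

lemma integrable_exponential_decay:
  fixes f :: "real \<Rightarrow> real"
  assumes cont: "continuous_on UNIV f" and "0 < \<gamma>"
    and decay: "\<And>x. X \<le> \<bar>x\<bar> \<Longrightarrow> \<bar>f x\<bar> \<le> C * exp (- \<gamma> * \<bar>x\<bar>)"
  shows "integrable lborel f"
proof (rule Bochner_Integration.integrable_bound)
  have "integrable lborel (\<lambda>x. indicator {-X..X} x *\<^sub>R f x)"
    by (intro borel_integrable_compact compact_Icc continuous_on_subset[OF cont]) auto
  then show "integrable lborel (\<lambda>x. \<bar>indicator {-X..X} x *\<^sub>R f x\<bar> + \<bar>C * exp (- \<gamma> * \<bar>x\<bar>)\<bar>)"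
    by (intro Bochner_Integration.integrable_add integrable_abs integrable_mult_right
        integrable_exp_minus_abs \<open>0 < \<gamma>\<close>)
  have "\<bar>f x\<bar> \<le> \<bar>indicator {-X..X} x *\<^sub>R f x\<bar> + \<bar>C * exp (- \<gamma> * \<bar>x\<bar>)\<bar>" for x
  proof (cases "X \<le> \<bar>x\<bar>")
    case True
    then show ?thesis using decay[of x] by linarith
  next
    case False
    then have "x \<in> {-X..X}" by auto
    then show ?thesis by simp
  qed
  then show "AE x in lborel. norm (f x)
      \<le> norm (\<bar>indicator {-X..X} x *\<^sub>R f x\<bar> + \<bar>C * exp (- \<gamma> * \<bar>x\<bar>)\<bar>)"
    by simp
qed (use cont in \<open>simp add: borel_measurable_continuous_onI\<close>)

lemma integrable_saddle_homoclinic: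
  fixes v v' :: "real \<Rightarrow> real"
  assumes v: "\<And>x. (v has_real_derivative v' x) (at x)" "\<And>x. (v' has_real_derivative f (v x)) (at x)"
    and f: "(f has_real_derivative \<kappa>) (at l)" "f l = 0" "0 < \<kappa>"
    and lim: "(v \<longlongrightarrow> l) at_infinity" "(v' \<longlongrightarrow> 0) at_infinity"
  shows "integrable lborel (\<lambda>x. v x - l)"
proof -
  let ?\<gamma> = "sqrt \<kappa> / 2"
  note lim_top = lim[THEN tendsto_mono[OF at_top_le_at_infinity]]
  note lim_bot = lim[THEN tendsto_mono[OF at_bot_le_at_infinity]]
  obtain X where right: "\<And>x. X \<le> x \<Longrightarrow> (v x - l)\<^sup>2 \<le> (v X - l)\<^sup>2 * exp (- sqrt \<kappa> * (x - X))"
    using saddle_exponential_decay[OF v f lim_top] by blast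
  obtain Y where left: "\<And>x. Y \<le> x \<Longrightarrow>
      (v (- x) - l)\<^sup>2 \<le> (v (- Y) - l)\<^sup>2 * exp (- sqrt \<kappa> * (x - Y))"
  proof (rule saddle_exponential_decay[of "\<lambda>x. v (- x)" "\<lambda>x. - v' (- x)" f])
    show "((\<lambda>x. v (- x)) has_real_derivative - v' (- x)) (at x)"
      and "((\<lambda>x. - v' (- x)) has_real_derivative f (v (- x))) (at x)" for x
      by (rule DERIV_reflect(1)[OF v(1)] DERIV_reflect(2)[OF v(2)])+
    show "((\<lambda>x. v (- x)) \<longlongrightarrow> l) at_top"
      using lim_bot(1) by (simp add: filterlim_at_bot_mirror)
    show "((\<lambda>x. - v' (- x)) \<longlongrightarrow> 0) at_top"
      using tendsto_minus[OF lim_bot(2)] by (simp add: filterlim_at_bot_mirror)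
  qed (use f in auto)
  define C where "C = max (\<bar>v X - l\<bar> * exp (?\<gamma> * X)) (\<bar>v (- Y) - l\<bar> * exp (?\<gamma> * Y))"
  show ?thesis
  proof (rule integrable_exponential_decay)
    show "continuous_on UNIV (\<lambda>x. v x - l)"
      by (intro continuous_intros DERIV_continuous_on[OF v(1)])
    show "0 < ?\<gamma>"
      using f(3) by simp
    fix x assume x: "max X Y \<le> \<bar>x\<bar>"
    have "\<bar>v x - l\<bar> \<le> \<bar>v X - l\<bar> * exp (?\<gamma> * X) * exp (- ?\<gamma> * \<bar>x\<bar>) \<or>
        \<bar>v x - l\<bar> \<le> \<bar>v (- Y) - l\<bar> * exp (?\<gamma> * Y) * exp (- ?\<gamma> * \<bar>x\<bar>)"
      using abs_le_of_power2_le_exp[of "v x - l" "v X - l" ?\<gamma> "\<bar>x\<bar>" X] right[of x]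
        abs_le_of_power2_le_exp[of "v x - l" "v (- Y) - l" ?\<gamma> "\<bar>x\<bar>" Y] left[of "- x"] x
      by (cases "0 \<le> x") auto
    moreover have "D * exp (- ?\<gamma> * \<bar>x\<bar>) \<le> C * exp (- ?\<gamma> * \<bar>x\<bar>)" if "D \<le> C" for D
      using that by (rule mult_right_mono) simp
    ultimately show "\<bar>v x - l\<bar> \<le> C * exp (- ?\<gamma> * \<bar>x\<bar>)"
      unfolding C_def by (meson max.cobounded1 max.cobounded2 order_trans)
  qed
qed

subsection \<open>The profile equation\<close>

definition wave_momentum :: "real \<Rightarrow> real \<Rightarrow> real \<Rightarrow> real" where
  "wave_momentum c k t = wave_a c k / sqrt (c - t\<^sup>2) ^ 3"

definition wave_potential :: "real \<Rightarrow> real \<Rightarrow> real \<Rightarrow> real" where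
  "wave_potential c k t = t\<^sup>2 / 2 - wave_a c k * t / (c * sqrt (c - t\<^sup>2))"

lemma convex_power2_less: "convex {t :: real. t\<^sup>2 < c}"
proof -
  have "t\<^sup>2 < c \<longleftrightarrow> t \<in> {- sqrt c<..<sqrt c}" for t
    using real_sqrt_less_iff[of "t\<^sup>2" c] by (auto simp: abs_less_iff)
  then have "{t. t\<^sup>2 < c} = {- sqrt c<..<sqrt c}"
    by blast
  then show ?thesis
    by (simp only: convex_real_interval)
qed

lemma DERIV_sqrt_diff_power2:
  assumes "t\<^sup>2 < c"
  shows "((\<lambda>t. sqrt (c - t\<^sup>2)) has_real_derivative - t / sqrt (c - t\<^sup>2)) (at t)"
  using assms by (auto intro!: derivative_eq_intros simp: field_simps)

lemma DERIV_wave_momentum: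
  assumes "t\<^sup>2 < c"
  shows "(wave_momentum c k has_real_derivative 3 * wave_a c k * t / sqrt (c - t\<^sup>2) ^ 5) (at t)"
proof -
  have cube: "3 * A * t / r ^ 5 = - 3 * A * (- t / r) / r ^ 4" for A r :: real
    by (simp add: eval_nat_numeral)
  show ?thesis
    unfolding wave_momentum_def[abs_def] cube
    by (rule DERIV_divide_cube[OF DERIV_sqrt_diff_power2[OF assms]]) (use assms in simp)
qed

lemma continuous_on_wave_momentum: "continuous_on {t. t\<^sup>2 < c} (wave_momentum c k)"
  by (auto intro!: continuous_at_imp_continuous_on DERIV_isCont DERIV_wave_momentum)

lemma DERIV_wave_potential:
  assumes "0 < c" "t\<^sup>2 < c"
  shows "(wave_potential c k has_real_derivative t - wave_momentum c k t) (at t)"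
proof -
  define r where "r = sqrt (c - t\<^sup>2)"
  have r: "0 < r" "r\<^sup>2 + t\<^sup>2 = c"
    using assms by (simp_all add: r_def)
  have quotient: "((\<lambda>t. t\<^sup>2 / 2 - A * t / (c * f t)) has_real_derivative
      t - A / c * ((f t - t * D) / (f t)\<^sup>2)) (at t)"
    if "(f has_real_derivative D) (at t)" "f t \<noteq> 0" for f :: "real \<Rightarrow> real" and A D
    using that \<open>0 < c\<close> by (auto intro!: derivative_eq_intros simp: field_simps power2_eq_square)
  have "(wave_potential c k has_real_derivative
      t - wave_a c k / c * ((r - t * (- t / r)) / r\<^sup>2)) (at t)"
    unfolding wave_potential_def[abs_def] r_def
    by (rule quotient[OF DERIV_sqrt_diff_power2[OF assms(2)]]) (use assms in simp)
  also have "(r - t * (- t / r)) / r\<^sup>2 = (r\<^sup>2 + t\<^sup>2) / r ^ 3"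
    using r(1) by (simp add: field_simps eval_nat_numeral)
  also have "wave_a c k / c * ((r\<^sup>2 + t\<^sup>2) / r ^ 3) = wave_momentum c k t"
    unfolding r(2) using \<open>0 < c\<close> by (simp add: wave_momentum_def r_def)
  finally show ?thesis .
qed

lemma wave_a_eq:
  assumes "k\<^sup>2 < c"
  shows "wave_a c k = k * sqrt (c - k\<^sup>2) ^ 3"
  using assms powr_half_sqrt_powr[of "c - k\<^sup>2" 3] by (simp add: wave_a_def real_sqrt_power)

lemma wave_momentum_end_state:
  assumes "k\<^sup>2 < c"
  shows "wave_momentum c k k = k"
  using assms by (simp add: wave_momentum_def wave_a_eq)

lemma wave_potential_end_state:
  assumes "0 < c" "k\<^sup>2 < c"
  shows "wave_potential c k k = - wave_E c k"
proof -
  have "wave_a c k * k / (c * sqrt (c - k\<^sup>2)) = k\<^sup>2 * (sqrt (c - k\<^sup>2))\<^sup>2 / c"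
    using assms by (simp add: wave_a_eq field_simps eval_nat_numeral)
  also have "\<dots> = k\<^sup>2 * (c - k\<^sup>2) / c"
    using assms by simp
  finally have "wave_potential c k k = k\<^sup>2 / 2 - k\<^sup>2 * (c - k\<^sup>2) / c"
    by (simp only: wave_potential_def)
  then show ?thesis
    using assms by (simp add: wave_E_def field_simps power2_eq_square)
qed

subsection \<open>The solitary wave\<close>

locale novikov_wave =
  fixes c k :: real and \<phi> :: "real \<Rightarrow> real"
  assumes c_pos: "0 < c" and k_pos: "0 < k" and k_less: "k < sqrt c / 2"
    and wave: "solitary_wave c k \<phi>"
begin

abbreviation a :: real where "a \<equiv> wave_a c k"
abbreviation E :: real where "E \<equiv> wave_E c k"
abbreviation \<mu> :: "real \<Rightarrow> real" where "\<mu> \<equiv> momentum \<phi>"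

definition r :: "real \<Rightarrow> real" where
  "r x = sqrt (c - (\<phi> x)\<^sup>2)"

definition r' :: "real \<Rightarrow> real" where
  "r' x = - \<phi> x * deriv \<phi> x / r x"

definition r'' :: "real \<Rightarrow> real" where
  "r'' x = - ((deriv \<phi> x)\<^sup>2 + \<phi> x * deriv (deriv \<phi>) x) / r x - (\<phi> x * deriv \<phi> x)\<^sup>2 / r x ^ 3"

lemma four_k_power2_less: "4 * k\<^sup>2 < c"
proof -
  have "(2 * k)\<^sup>2 < (sqrt c)\<^sup>2"
    using k_pos k_less by (intro power_strict_mono) auto
  then show ?thesis using c_pos by (simp add: power_mult_distrib)
qed

lemma k_power2_less: "k\<^sup>2 < c"
  using four_k_power2_less zero_le_power2[of k] by linarith

lemma a_pos: "0 < a"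
  using k_pos k_power2_less by (simp add: wave_a_eq)

lemma \<phi>_power2_less: "(\<phi> x)\<^sup>2 < c"
  using wave by (simp add: solitary_wave_def)

lemma r_pos: "0 < r x" and r_power2: "(r x)\<^sup>2 = c - (\<phi> x)\<^sup>2"
  using \<phi>_power2_less[of x] by (simp_all add: r_def)

lemma \<phi>_limit: "(\<phi> \<longlongrightarrow> k) at_infinity"
  using wave by (simp add: solitary_wave_def at_infinity_eq_at_top_bot filterlim_sup)

lemma DERIV_\<phi>: "(\<phi> has_real_derivative deriv \<phi> x) (at x)"
  and DERIV_deriv_\<phi>: "(deriv \<phi> has_real_derivative deriv (deriv \<phi>) x) (at x)"
  using smooth_has_derivative[of \<phi> 0 x] smooth_has_derivative[of \<phi> 1 x] wave
  by (simp_all add: solitary_wave_def)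

lemma continuous_on_\<phi>: "continuous_on A \<phi>" "continuous_on A (deriv \<phi>)"
    "continuous_on A (deriv (deriv \<phi>))"
  using smooth_deriv_continuous[of \<phi> A 0] smooth_deriv_continuous[of \<phi> A 1]
    smooth_deriv_continuous[of \<phi> A 2] wave
  by (simp_all add: solitary_wave_def numeral_2_eq_2)

lemma \<mu>_eq_cube: "\<mu> x = a / r x ^ 3"
proof -
  have "(c - (\<phi> x)\<^sup>2) powr (- 3/2) = 1 / r x ^ 3"
    using powr_half_sqrt_powr[of "c - (\<phi> x)\<^sup>2" "- 3"] \<phi>_power2_less[of x]
    by (simp add: r_def powr_minus_divide real_sqrt_power real_sqrt_divide)
  then show ?thesis
    using wave by (simp add: solitary_wave_def momentum_def)
qed

lemma \<mu>_eq_wave_momentum: "\<mu> x = wave_momentum c k (\<phi> x)"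
  by (simp add: \<mu>_eq_cube r_def wave_momentum_def)

lemma profile_equation: "deriv (deriv \<phi>) x = \<phi> x - wave_momentum c k (\<phi> x)"
  using \<mu>_eq_wave_momentum[of x] by (simp add: momentum_def)

lemma \<mu>_pos: "0 < \<mu> x"
  using a_pos r_pos[of x] by (simp add: \<mu>_eq_cube)

lemma \<mu>_limit: "(\<mu> \<longlongrightarrow> k) at_infinity"
  using isCont_tendsto_compose
    [OF DERIV_isCont[OF DERIV_wave_momentum[OF k_power2_less, where k = k]] \<phi>_limit]
  by (simp add: \<mu>_eq_wave_momentum[abs_def] wave_momentum_end_state[OF k_power2_less])

lemma first_integral: "(deriv \<phi> x)\<^sup>2 = 2 * (wave_potential c k (\<phi> x) - wave_potential c k k)"
proof (rule homoclinic_first_integral[OF DERIV_\<phi>])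
  show "(deriv \<phi> has_real_derivative \<phi> x - wave_momentum c k (\<phi> x)) (at x)" for x
    using DERIV_deriv_\<phi>[of x] by (simp only: profile_equation)
  show "isCont (wave_potential c k) k"
    by (rule DERIV_isCont[OF DERIV_wave_potential[OF c_pos k_power2_less]])
  show "(\<phi> \<longlongrightarrow> k) at_top"
    using wave by (simp add: solitary_wave_def)
qed (rule DERIV_wave_potential[OF c_pos \<phi>_power2_less])

lemma deriv_\<phi>_limit: "(deriv \<phi> \<longlongrightarrow> 0) at_infinity"
proof -
  have "((\<lambda>x. 2 * (wave_potential c k (\<phi> x) - wave_potential c k k))
      \<longlongrightarrow> 2 * (wave_potential c k k - wave_potential c k k)) at_infinity"
    by (intro tendsto_intros isCont_tendsto_compose[OF _ \<phi>_limit]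
        DERIV_isCont[OF DERIV_wave_potential[OF c_pos k_power2_less]])
  then have "((\<lambda>x. (deriv \<phi> x)\<^sup>2) \<longlongrightarrow> 0) at_infinity"
    by (simp add: first_integral)
  from tendsto_real_sqrt[OF this] show ?thesis
    by (simp add: tendsto_rabs_zero_iff)
qed

lemma helmholtz_inv_\<mu>: "helmholtz_inv \<mu> x = \<phi> x"
proof -
  have "(deriv (deriv \<phi>) \<longlongrightarrow> k - k) at_infinity"
    using tendsto_diff[OF \<phi>_limit \<mu>_limit]
    by (simp add: profile_equation[abs_def] \<mu>_eq_wave_momentum[abs_def])
  note bounded = bounded_range_limit_at_infinity[OF continuous_on_\<phi>(1) \<phi>_limit]
    bounded_range_limit_at_infinity[OF continuous_on_\<phi>(2) deriv_\<phi>_limit]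
    bounded_range_limit_at_infinity[OF continuous_on_\<phi>(3) this]
  show ?thesis
    unfolding momentum_def[abs_def]
    by (rule helmholtz_inv_inverse[OF DERIV_\<phi> DERIV_deriv_\<phi> continuous_on_\<phi>(3) bounded])
qed

lemma integrable_\<phi>_diff: "integrable lborel (\<lambda>x. \<phi> x - k)"
proof (rule integrable_saddle_homoclinic[OF DERIV_\<phi> _ _ _ _ \<phi>_limit deriv_\<phi>_limit])
  let ?f = "\<lambda>t. t - wave_momentum c k t"
  show "(deriv \<phi> has_real_derivative ?f (\<phi> x)) (at x)" for x
    using DERIV_deriv_\<phi>[of x] by (simp only: profile_equation)
  show "(?f has_real_derivative 1 - 3 * a * k / sqrt (c - k\<^sup>2) ^ 5) (at k)"
    using k_power2_less by (auto intro!: derivative_eq_intros DERIV_wave_momentum)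
  show "?f k = 0"
    by (simp add: wave_momentum_end_state[OF k_power2_less])
  have "3 * (k * R ^ 3) * k / R ^ 5 = 3 * k\<^sup>2 / R\<^sup>2" if "0 < R" for R
    using that by (simp add: field_simps eval_nat_numeral)
  from this[of "sqrt (c - k\<^sup>2)"]
  have "3 * a * k / sqrt (c - k\<^sup>2) ^ 5 = 3 * k\<^sup>2 / (sqrt (c - k\<^sup>2))\<^sup>2"
    using k_power2_less by (simp only: wave_a_eq) simp
  also have "\<dots> < 1"
    using four_k_power2_less k_power2_less by simp
  finally show "0 < 1 - 3 * a * k / sqrt (c - k\<^sup>2) ^ 5"
    by simp
qed

lemma \<phi>_range: "insert k (range \<phi>) \<subseteq> {t. t\<^sup>2 < c}"
  using \<phi>_power2_less k_power2_less by auto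

lemma \<mu>_range: "insert k (range \<mu>) \<subseteq> {0<..}"
  using \<mu>_pos k_pos by auto

lemma integrable_comp_\<phi>:
  assumes "\<And>t. t\<^sup>2 < c \<Longrightarrow> (G has_real_derivative G' t) (at t)" "continuous_on {t. t\<^sup>2 < c} G'"
  shows "integrable lborel (\<lambda>x. G (\<phi> x) - G k)"
  using assms by (intro integrable_comp_diff_limit[OF continuous_on_\<phi>(1) \<phi>_limit \<phi>_range
      convex_power2_less _ _ integrable_\<phi>_diff]) auto

lemma continuous_on_\<mu>: "continuous_on A \<mu>" "continuous_on A (deriv \<mu>)"
    "continuous_on A (deriv (deriv \<mu>))"
  and DERIV_\<mu>: "(\<mu> has_real_derivative deriv \<mu> x) (at x)"
  and DERIV_deriv_\<mu>: "(deriv \<mu> has_real_derivative deriv (deriv \<mu>) x) (at x)"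
proof -
  have "smooth \<mu>"
    using wave by (simp add: smooth_momentum solitary_wave_def)
  from smooth_deriv_continuous[OF this, of A 0] smooth_deriv_continuous[OF this, of A 1]
    smooth_deriv_continuous[OF this, of A 2] smooth_has_derivative[OF this, of 0 x]
    smooth_has_derivative[OF this, of 1 x]
  show "continuous_on A \<mu>" "continuous_on A (deriv \<mu>)" "continuous_on A (deriv (deriv \<mu>))"
    "(\<mu> has_real_derivative deriv \<mu> x) (at x)"
    "(deriv \<mu> has_real_derivative deriv (deriv \<mu>) x) (at x)"
    by (simp_all add: numeral_2_eq_2)
qed

lemma integrable_\<mu>_diff: "integrable lborel (\<lambda>x. \<mu> x - k)"
proof -
  have "integrable lborel (\<lambda>x. wave_momentum c k (\<phi> x) - wave_momentum c k k)"
    by (rule integrable_comp_\<phi>[OF DERIV_wave_momentum]) (auto intro!: continuous_intros)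
  then show ?thesis
    by (simp add: \<mu>_eq_wave_momentum wave_momentum_end_state[OF k_power2_less])
qed

lemma integrable_comp_\<mu>:
  assumes "\<And>t. 0 < t \<Longrightarrow> (G has_real_derivative G' t) (at t)" "continuous_on {0<..} G'"
  shows "integrable lborel (\<lambda>x. G (\<mu> x) - G k)"
  using assms by (intro integrable_comp_diff_limit[OF continuous_on_\<mu>(1) \<mu>_limit \<mu>_range
      convex_real_interval(3) _ _ integrable_\<mu>_diff]) auto

lemma integrable_deriv_\<mu>_power2: "integrable lborel (\<lambda>x. (deriv \<mu> x)\<^sup>2)"
proof -
  have "integrable lborel (\<lambda>x. wave_potential c k (\<phi> x) - wave_potential c k k)"
    by (rule integrable_comp_\<phi>[OF DERIV_wave_potential[OF c_pos]])
       (auto intro!: continuous_intros continuous_on_wave_momentum)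
  from integrable_mult_right[OF this, of 2] have "integrable lborel (\<lambda>x. (deriv \<phi> x)\<^sup>2)"
    by (simp only: first_integral)
  then have "integrable lborel (\<lambda>x. (3 * a * \<phi> x / sqrt (c - (\<phi> x)\<^sup>2) ^ 5)\<^sup>2 * (deriv \<phi> x)\<^sup>2)"
    by (rule integrable_comp_mult[OF continuous_on_\<phi>(1) \<phi>_limit \<phi>_range, rotated])
       (auto intro!: continuous_intros)
  moreover have "deriv \<mu> x = 3 * a * \<phi> x / sqrt (c - (\<phi> x)\<^sup>2) ^ 5 * deriv \<phi> x" for x
    using DERIV_chain2[OF DERIV_wave_momentum[OF \<phi>_power2_less, where k = k] DERIV_\<phi>]
    by (intro DERIV_imp_deriv) (simp add: \<mu>_eq_wave_momentum[abs_def])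
  ultimately show ?thesis
    by (simp only: power_mult_distrib)
qed

lemma integrable_\<mu>_powr: "integrable lborel (\<lambda>x. \<mu> x powr p - k powr p)"
  by (rule integrable_comp_\<mu>[OF has_real_derivative_powr]) (auto intro!: continuous_intros)

lemma \<mu>_in_action_domain: "\<mu> \<in> action_domain k"
proof -
  have "integrable lborel (\<lambda>x. (\<mu> x - k)\<^sup>2 - (k - k)\<^sup>2)"
    by (rule integrable_comp_\<mu>[where G' = "\<lambda>t. 2 * (t - k)"])
       (auto intro!: derivative_eq_intros continuous_intros)
  then have "(\<lambda>x. \<mu> x - k) \<in> sobolev_H1"
    by (intro sobolev_H1I[where f' = "deriv \<mu>"] continuous_on_\<mu> integrable_deriv_\<mu>_power2)
       (auto intro!: derivative_eq_intros DERIV_\<mu>)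
  then have "\<mu> \<in> X_space k"
    by (simp add: X_space_def \<mu>_pos)
  moreover have "integrable lborel (energy_density k \<mu>)"
  proof -
    have "integrable lborel (\<lambda>x. wave_momentum c k (\<phi> x) * \<phi> x - wave_momentum c k k * k)"
      by (rule integrable_comp_\<phi>[OF DERIV_mult[OF DERIV_wave_momentum DERIV_ident]])
         (auto intro!: continuous_intros continuous_on_wave_momentum)
    then show ?thesis
      by (simp add: energy_density_def[abs_def] helmholtz_inv_\<mu> \<mu>_eq_wave_momentum
          wave_momentum_end_state[OF k_power2_less] power2_eq_square)
  qed
  moreover have "integrable lborel (F1_density k \<mu>)"
    unfolding F1_density_def[abs_def] by (rule integrable_\<mu>_powr)
  moreover have "integrable lborel (F2_density k \<mu>)"
  proof -
    have "integrable lborel (\<lambda>x. \<mu> x powr (-8/3) * (deriv \<mu> x)\<^sup>2)"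
      by (rule integrable_comp_mult[OF continuous_on_\<mu>(1) \<mu>_limit \<mu>_range _ integrable_deriv_\<mu>_power2])
         (auto intro!: continuous_intros)
    then show ?thesis
      unfolding F2_density_def[abs_def]
      by (intro Bochner_Integration.integrable_add integrable_mult_right integrable_\<mu>_powr)
  qed
  ultimately show ?thesis
    by (simp add: action_domain_def)
qed

lemma DERIV_r: "(r has_real_derivative r' x) (at x)"
  using DERIV_chain2[OF DERIV_sqrt_diff_power2[OF \<phi>_power2_less] DERIV_\<phi>]
  by (simp add: r_def[abs_def] r'_def)

lemma DERIV_r': "(r' has_real_derivative r'' x) (at x)"
proof -
  have "r x \<noteq> 0"
    using r_pos[of x] by simp
  then show ?thesis
    unfolding r'_def[abs_def] r''_def
    by (auto intro!: derivative_eq_intros DERIV_r DERIV_\<phi> DERIV_deriv_\<phi>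
        simp: r'_def field_simps eval_nat_numeral)
qed

lemma r_equation: "r x ^ 4 * (r x - r'' x) = c * (2 * E + c) * r x - 3 * a * \<phi> x"
proof -
  define R where "R = r x"
  define q where "q = a / R"
  define P where "P = (deriv \<phi> x)\<^sup>2"
  have R: "0 < R" "R\<^sup>2 = c - (\<phi> x)\<^sup>2" and a: "a = q * R"
    using r_pos[of x] r_power2[of x] by (simp_all add: R_def q_def)
  have \<phi>'': "R\<^sup>2 * deriv (deriv \<phi>) x = R\<^sup>2 * \<phi> x - q"
    using R(1) unfolding profile_equation \<mu>_eq_wave_momentum[symmetric] \<mu>_eq_cube R_def[symmetric]
    by (simp add: a field_simps eval_nat_numeral)
  have P: "c * P = c * (2 * E + (\<phi> x)\<^sup>2) - 2 * \<phi> x * q"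
    using c_pos R(1) unfolding P_def first_integral wave_potential_end_state[OF c_pos k_power2_less]
    by (simp add: wave_potential_def r_def[symmetric] R_def[symmetric] a field_simps)
  have "R ^ 4 * r'' x = - R * ((R\<^sup>2 + (\<phi> x)\<^sup>2) * P + \<phi> x * (R\<^sup>2 * deriv (deriv \<phi>) x))"
    using R(1) unfolding r''_def R_def[symmetric] power_mult_distrib P_def[symmetric]
    by (simp add: field_simps eval_nat_numeral)
  also have "\<dots> = - R * (c * P + \<phi> x * (R\<^sup>2 * \<phi> x - q))"
    unfolding \<phi>'' by (simp add: R(2))
  finally have "R ^ 4 * (R - r'' x) = R * ((R\<^sup>2)\<^sup>2 + c * P + \<phi> x * (R\<^sup>2 * \<phi> x - q))"
    by (simp add: algebra_simps)
  also have "\<dots> = c * (2 * E + c) * R - 3 * a * \<phi> x"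
    unfolding a P R(2) by (simp add: algebra_simps power2_eq_square)
  finally show ?thesis
    by (simp only: R_def)
qed

lemma action_gradient_\<mu>:
  "action_gradient (-9 * a powr (-2/3)) (9 * c * a powr (-4/3) * (2 * E + c)) \<mu> x = 0"
proof -
  define b where "b = a powr (1/3)"
  have b: "0 < b" "a = b ^ 3" "a powr (-2/3) = 1 / b ^ 2" "a powr (-4/3) = 1 / b ^ 4"
    using a_pos by (simp_all add: b_def powr_power powr_minus_divide)
  have \<mu>: "\<mu> = (\<lambda>x. 1 / (r x / b) ^ 3)"
    by (simp add: fun_eq_iff \<mu>_eq_cube b(2) power_divide)
  have "((\<lambda>x. r x / b) has_real_derivative r' x / b) (at x)"
    and "((\<lambda>x. r' x / b) has_real_derivative r'' x / b) (at x)" for x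
    by (intro DERIV_cdivide DERIV_r DERIV_r')+
  then have "action_gradient (-9 * a powr (-2/3)) (9 * c * a powr (-4/3) * (2 * E + c)) \<mu> x
      = 2 * (-9 * (1 / b ^ 2)) * \<phi> x + 2 / 3 * (9 * c * (1 / b ^ 4) * (2 * E + c)) * (r x / b)
        - 6 * (r x / b) ^ 4 * (r x / b - r'' x / b)"
    using r_pos b(1) helmholtz_inv_\<mu>[of x] unfolding \<mu> b(3,4)
    by (subst action_gradient_inverse_cube) auto
  also have "\<dots> = 6 / b ^ 5 * (c * (2 * E + c) * r x - 3 * b ^ 3 * \<phi> x - r x ^ 4 * (r x - r'' x))"
    using b(1) by (simp add: field_simps eval_nat_numeral)
  also have "\<dots> = 0"
    unfolding r_equation b(2) by simp
  finally show ?thesis .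
qed

end

theorem proposition2p7:
  fixes c k a E \<omega>0 \<omega>1 :: real and \<phi> \<mu> :: "real \<Rightarrow> real"
  assumes "c > 0" and "0 < k" and "k < sqrt c / 2"
    and "a = wave_a c k" and "E = wave_E c k"
    and "solitary_wave c k \<phi>" and "\<mu> = momentum \<phi>"
    and "\<omega>0 = -9 * a powr (-2/3)"
    and "\<omega>1 = 9 * c * a powr (-4/3) * (2 * E + c)"
  shows "critical_point (action_domain k) (action k \<omega>0 \<omega>1) \<mu> \<and>
         (\<forall>x. action_gradient \<omega>0 \<omega>1 \<mu> x = 0)"
proof -
  interpret novikov_wave c k \<phi>
    by unfold_locales (rule assms)+
  have gradient: "action_gradient \<omega>0 \<omega>1 \<mu> = (\<lambda>x. 0)"
    unfolding assms(4,5,7-9) using action_gradient_\<mu> by blast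
  have domain: "\<mu> \<in> action_domain k"
    unfolding assms(7) by (rule \<mu>_in_action_domain)
  have "has_variational_derivative (action_domain k) (action k \<omega>0 \<omega>1) \<mu> (action_gradient \<omega>0 \<omega>1 \<mu>)"
    unfolding assms(7)
    by (intro action_has_variational_derivative[OF _ _ DERIV_\<mu> DERIV_deriv_\<mu>] \<mu>_in_action_domain
        bounded_range_limit_at_infinity[OF _ \<mu>_limit] continuous_on_\<mu>)
  with domain show ?thesis
    by (simp add: critical_point_def gradient)
qed

end
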